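(* Let $\alpha_1,\alpha_2$ be irreducible affine isometric actions of a topological group $G$ on Hilbert spaces $\mathcal H_1,\mathcal H_2$. The following properties are equivalent: (i) The direct sum $\alpha_1\oplus\alpha_2$ on $\mathcal H_1\oplus\mathcal H_2$ is reducible (i.e. not irreducible). (ii) $\alpha_1$ and $\alpha_2$ admit equivalent projected actions; that is, there are non-zero closed subspaces $\mathcal K_1\subset\mathcal H_1$, $\mathcal K_2\subset\mathcal H_2$, invariant under the linear parts of $\alpha_1,\alpha_2$ respectively, such that the projected action of $\alpha_1$ on $\mathcal K_1$ is equivalent to the projected action of $\alpha_2$ on $\mathcal K_2$.
   Context: An affine isometric action of $G$ on $\mathcal H$ has the form $\alpha(g)v=\pi(g)v+b(g)$ with $\pi$ a continuous unitary representation (the linear part) and $b:G\to\mathcal H$ continuous with $b(gh)=b(g)+\pi(g)b(h)$. It is irreducible if $\mathcal H$ has no non-empty, closed, proper $\alpha(G)$-invariant affine subspace. The direct sum is $(\alpha_1\oplus\alpha_2)(g)(v_1,v_2)=(\alpha_1(g)v_1,\alpha_2(g)v_2)$. If $\mathcal K\subset\mathcal H$ is a closed $\pi(G)$-invariant linear subspace and $b_{\mathcal K}(g)$ is the orthogonal projection of $b(g)$ on $\mathcal K$, the projected action of $\alpha$ on $\mathcal K$ is $g\mapsto(v\mapsto\pi(g)v+b_{\mathcal K}(g))$. Two affine isometric actions $\beta_1,\beta_2$ of $G$ on Hilbert spaces $\mathcal K_1,\mathcal K_2$ are equivalent if there is an invertible continuous affine map $A:\mathcal K_1\to\mathcal K_2$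 (not necessarily isometric) with $A\beta_1(g)=\beta_2(g)A$ for all $g\in G$. *)

theory Defs
  imports "HOL-Analysis.Analysis"
begin

subsection \<open>Complex Hilbert spaces\<close>

text \<open>
  The underlying real inner product (and hence the norm and the topology) is the real part of the
  Hermitian form; definiteness of the form is inherited from \<^class>\<open>real_inner\<close>.
\<close>

class complex_inner = real_inner +
  fixes scaleC :: "complex \<Rightarrow> 'a \<Rightarrow> 'a"  (infixr "*\<^sub>C" 75)
    and cinner :: "'a \<Rightarrow> 'a \<Rightarrow> complex"
  assumes scaleC_add_right: "c *\<^sub>C (x + y) = c *\<^sub>C x + c *\<^sub>C y"
    and scaleC_add_left: "(c + d) *\<^sub>C x = c *\<^sub>C x + d *\<^sub>C x"
    and scaleC_scaleC: "c *\<^sub>C d *\<^sub>C x = (c * d) *\<^sub>C x"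
    and scaleC_of_real: "complex_of_real r *\<^sub>C x = r *\<^sub>R x"
    and cinner_commute: "cinner x y = cnj (cinner y x)"
    and cinner_add_left: "cinner (x + y) z = cinner x z + cinner y z"
    and cinner_scaleC_left: "cinner (c *\<^sub>C x) y = c * cinner x y"
    and Re_cinner: "Re (cinner x y) = inner x y"

class complex_hilbert = complex_inner + complete_space

lemma cinner_self:
  fixes x :: "'a::complex_inner"
  shows "cinner x x = complex_of_real ((norm x)\<^sup>2)"
proof -
  have "Im (cinner x x) = 0"
    using arg_cong[OF cinner_commute[of x x], of Im] by simp
  then show ?thesis
    by (simp add: complex_eq_iff Re_cinner power2_norm_eq_inner)
qed

global_interpretation complex_vector:
  vector_space "scaleC :: complex \<Rightarrow> 'a \<Rightarrow> 'a::complex_inner"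
  defines csubspace = complex_vector.subspace
proof
  fix c d :: complex and x y :: 'a
  show "1 *\<^sub>C x = x"
    using scaleC_of_real[of 1 x] by simp
qed (simp_all add: scaleC_add_right scaleC_add_left scaleC_scaleC)

abbreviation clinear :: "('a::complex_inner \<Rightarrow> 'b::complex_inner) \<Rightarrow> bool" where
  "clinear \<equiv> Vector_Spaces.linear scaleC scaleC"

text \<open>The complex analogue of \<^const>\<open>affine\<close>; like there, the empty set qualifies.\<close>

definition caffine :: "'a::complex_inner set \<Rightarrow> bool" where
  "caffine S \<longleftrightarrow> (\<forall>x\<in>S. \<forall>y\<in>S. \<forall>u v. u + v = 1 \<longrightarrow> u *\<^sub>C x + v *\<^sub>C y \<in> S)"

definition caffine_map_on ::
    "'a::complex_inner set \<Rightarrow> ('a \<Rightarrow> 'b::complex_inner) \<Rightarrow> bool" where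
  "caffine_map_on S A \<longleftrightarrow>
     (\<forall>x\<in>S. \<forall>y\<in>S. \<forall>u v. u + v = 1 \<longrightarrow> A (u *\<^sub>C x + v *\<^sub>C y) = u *\<^sub>C A x + v *\<^sub>C A y)"

text \<open>For a closed subspace \<open>K\<close> the point described here exists and is unique.\<close>

definition orth_proj :: "'a::complex_hilbert set \<Rightarrow> 'a \<Rightarrow> 'a" where
  "orth_proj K x = (THE y. y \<in> K \<and> (\<forall>z\<in>K. cinner (x - y) z = 0))"

text \<open>The Hilbert space direct sum of two spaces is their product type.\<close>

instantiation prod :: (complex_inner, complex_inner) complex_inner
begin

definition scaleC_prod :: "complex \<Rightarrow> 'a \<times> 'b \<Rightarrow> 'a \<times> 'b" where
  "scaleC_prod c x = (c *\<^sub>C fst x, c *\<^sub>C snd x)"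

definition cinner_prod :: "'a \<times> 'b \<Rightarrow> 'a \<times> 'b \<Rightarrow> complex" where
  "cinner_prod x y = cinner (fst x) (fst y) + cinner (snd x) (snd y)"

instance
proof
  fix x y :: "'a \<times> 'b"
  show "cinner x y = cnj (cinner y x)"
    using cinner_commute[of "fst x" "fst y"] cinner_commute[of "snd x" "snd y"]
    by (simp add: cinner_prod_def)
qed (auto simp: scaleC_prod_def cinner_prod_def scaleC_add_right scaleC_add_left scaleC_scaleC
       scaleC_of_real cinner_add_left cinner_scaleC_left Re_cinner inner_prod_def
       scaleR_prod_def algebra_simps)

end

instance prod :: (complex_hilbert, complex_hilbert) complex_hilbert ..


subsection \<open>Affine isometric actions\<close>

text \<open>
  Topological groups are the types of class \<^class>\<open>topological_group_add\<close>: the group law is written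
  \<open>+\<close>, but it is not assumed to be commutative, nor the topology to be Hausdorff.
\<close>

definition unitary_op :: "('a::complex_hilbert \<Rightarrow> 'a) \<Rightarrow> bool" where
  "unitary_op U \<longleftrightarrow> clinear U \<and> surj U \<and> (\<forall>x y. cinner (U x) (U y) = cinner x y)"

text \<open>Continuity of a unitary representation is strong continuity.\<close>

definition unitary_rep :: "('g::topological_group_add \<Rightarrow> 'a::complex_hilbert \<Rightarrow> 'a) \<Rightarrow> bool" where
  "unitary_rep \<pi> \<longleftrightarrow>
     (\<forall>g. unitary_op (\<pi> g)) \<and> \<pi> 0 = id \<and> (\<forall>g h. \<pi> (g + h) = \<pi> g \<circ> \<pi> h) \<and>
     (\<forall>v. continuous_on UNIV (\<lambda>g. \<pi> g v))"

definition cocycle ::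
    "('g::topological_group_add \<Rightarrow> 'a::complex_hilbert \<Rightarrow> 'a) \<Rightarrow> ('g \<Rightarrow> 'a) \<Rightarrow> bool" where
  "cocycle \<pi> b \<longleftrightarrow> continuous_on UNIV b \<and> (\<forall>g h. b (g + h) = b g + \<pi> g (b h))"

definition affine_isometric_action ::
    "('g::topological_group_add \<Rightarrow> 'a::complex_hilbert \<Rightarrow> 'a) \<Rightarrow> bool" where
  "affine_isometric_action \<alpha> \<longleftrightarrow>
     (\<exists>\<pi> b. unitary_rep \<pi> \<and> cocycle \<pi> b \<and> \<alpha> = (\<lambda>g v. \<pi> g v + b g))"

text \<open>The pair \<open>(\<pi>, b)\<close> is determined by \<open>\<alpha>\<close>, see \<open>linear_part_eq\<close> and \<open>translation_part_eq\<close>.\<close>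

definition linear_part :: "('g \<Rightarrow> 'a::complex_hilbert \<Rightarrow> 'a) \<Rightarrow> 'g \<Rightarrow> 'a \<Rightarrow> 'a" where
  "linear_part \<alpha> g v = \<alpha> g v - \<alpha> g 0"

definition translation_part :: "('g \<Rightarrow> 'a::complex_hilbert \<Rightarrow> 'a) \<Rightarrow> 'g \<Rightarrow> 'a" where
  "translation_part \<alpha> g = \<alpha> g 0"

lemma unitary_rep_zero: "unitary_rep \<pi> \<Longrightarrow> \<pi> g 0 = 0"
  unfolding unitary_rep_def unitary_op_def Vector_Spaces.linear_def
  by (metis module_hom.zero)

lemma linear_part_eq: "unitary_rep \<pi> \<Longrightarrow> linear_part (\<lambda>g v. \<pi> g v + b g) = \<pi>"
  by (simp add: fun_eq_iff linear_part_def unitary_rep_zero)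

lemma translation_part_eq: "unitary_rep \<pi> \<Longrightarrow> translation_part (\<lambda>g v. \<pi> g v + b g) = b"
  by (simp add: fun_eq_iff translation_part_def unitary_rep_zero)

definition irreducible_action :: "('g \<Rightarrow> 'a::complex_hilbert \<Rightarrow> 'a) \<Rightarrow> bool" where
  "irreducible_action \<alpha> \<longleftrightarrow>
     \<not> (\<exists>S. S \<noteq> {} \<and> closed S \<and> S \<noteq> UNIV \<and> caffine S \<and> (\<forall>g. \<alpha> g ` S \<subseteq> S))"

definition direct_sum_action ::
    "('g \<Rightarrow> 'a \<Rightarrow> 'a) \<Rightarrow> ('g \<Rightarrow> 'b \<Rightarrow> 'b) \<Rightarrow> 'g \<Rightarrow> 'a \<times> 'b \<Rightarrow> 'a \<times> 'b"
    (infixr "\<oplus>\<^sub>a" 65) where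
  "(\<alpha>\<^sub>1 \<oplus>\<^sub>a \<alpha>\<^sub>2) g = (\<lambda>(v\<^sub>1, v\<^sub>2). (\<alpha>\<^sub>1 g v\<^sub>1, \<alpha>\<^sub>2 g v\<^sub>2))"

definition closed_invariant_subspace ::
    "('g \<Rightarrow> 'a::complex_hilbert \<Rightarrow> 'a) \<Rightarrow> 'a set \<Rightarrow> bool" where
  "closed_invariant_subspace \<pi> K \<longleftrightarrow> csubspace K \<and> closed K \<and> (\<forall>g. \<pi> g ` K \<subseteq> K)"

text \<open>
  Only the restriction of the following map to \<open>K\<close> is meaningful: it is an action on \<open>K\<close>, which is
  why the notion of equivalence below takes the underlying spaces as arguments.
\<close>

definition projected_action ::
    "('g \<Rightarrow> 'a::complex_hilbert \<Rightarrow> 'a) \<Rightarrow> 'a set \<Rightarrow> 'g \<Rightarrow> 'a \<Rightarrow> 'a" where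
  "projected_action \<alpha> K g v = linear_part \<alpha> g v + orth_proj K (translation_part \<alpha> g)"

text \<open>
  Continuity of the inverse of \<open>A\<close> is not demanded; for closed subspaces of Hilbert spaces it is
  automatic by the open mapping theorem.
\<close>

definition equivalent_actions ::
    "'a::complex_hilbert set \<Rightarrow> ('g \<Rightarrow> 'a \<Rightarrow> 'a) \<Rightarrow> 'b::complex_hilbert set \<Rightarrow> ('g \<Rightarrow> 'b \<Rightarrow> 'b) \<Rightarrow> bool" where
  "equivalent_actions K\<^sub>1 \<beta>\<^sub>1 K\<^sub>2 \<beta>\<^sub>2 \<longleftrightarrow>
     (\<exists>A. bij_betw A K\<^sub>1 K\<^sub>2 \<and> continuous_on K\<^sub>1 A \<and> caffine_map_on K\<^sub>1 A \<and>
        (\<forall>g. \<forall>v\<in>K\<^sub>1. A (\<beta>\<^sub>1 g v) = \<beta>\<^sub>2 g (A v)))"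

end

theory Submission
  imports Defs
begin

text \<open>
  A proper invariant affine subspace of the direct sum has an orthogonal direction \<open>W \<noteq> 0\<close>, on which
  the projected action of \<open>\<alpha>\<^sub>1 \<oplus>\<^sub>a \<alpha>\<^sub>2\<close> has a fixed point. By irreducibility \<open>W\<close> meets neither summand, so
  it is the graph of an injective, closed, but in general unbounded intertwiner. A spectral cut-off, obtained
  from the absolute value of a self-adjoint operator in place of the spectral theorem, yields a nonzero
  invariant subspace \<open>M\<close> of \<open>W\<close> on which both coordinate projections are bounded below; their images of \<open>M\<close>
  carry equivalent projected actions. Conversely, an equivalence of projected actions has an
  affine graph, whose preimage under the projections is a proper invariant subspace.
\<close>

subsection \<open>Hilbert projection and spectral subspaces\<close>

text \<open>The obstacle is that the operator T with graph \<open>W\<close> need be neither bounded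
  nor boundedly invertible: the coordinate images of \<open>W\<close> need not be closed, and T
  gives no continuous bijection between closed subspaces. The compression \<open>R\<close> to
  \<open>W\<close> of the first coordinate projection plays the role of (1 + T* T)^(-1):
  \<open>R\<close> is small where T is large and close to 1 where T is small, so R - R^2 detects
  both defects. \<open>M\<close> is cut out by a polynomial in \<open>R\<close>, hence is preserved
  by whatever commutes with the projection onto \<open>W\<close> and with the first coordinate
  projection. This yields invariance under the group and under complex scalars alike, and allows the
  spectral part to be carried out over the reals. With T now denoting the bounded, invertible
  operator with graph \<open>M\<close>, a pair (v, w) is orthogonal to \<open>M\<close> exactly if v
  + T* w is orthogonal to the domain of T. The fixed point on \<open>M\<close> therefore relates the
  two cocycles through T*, and the linear part of the equivalence is the negative inverse of T*, not
  T itself.\<close>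

text \<open>A minimising sequence for the distance from \<open>x\<close> to \<open>K\<close> is
  Cauchy by the parallelogram law, and at the minimiser no direction of \<open>K\<close> can
  decrease the distance.\<close>

lemma ex_orthogonal_projection:
  fixes K :: "'a::{real_inner,complete_space} set"
  assumes K: "subspace K" "closed K"
  shows "\<exists>y\<in>K. \<forall>z\<in>K. inner (x - y) z = 0"
proof -
  define d where "d = Inf ((\<lambda>y. (norm (x - y))\<^sup>2) ` K)"
  have bdd: "bdd_below ((\<lambda>y. (norm (x - y))\<^sup>2) ` K)"
    by (rule bdd_belowI[of _ 0]) auto
  have d_le: "d \<le> (norm (x - y))\<^sup>2" if "y \<in> K" for y
    unfolding d_def using that by (intro cInf_lower bdd) auto
  have "\<exists>y\<in>K. (norm (x - y))\<^sup>2 < d + 1 / real (Suc n)" for n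
  proof -
    have "K \<noteq> {}" using K(1) subspace_0 by blast
    then have "\<exists>a\<in>(\<lambda>y. (norm (x - y))\<^sup>2) ` K. a < d + 1 / real (Suc n)"
      unfolding d_def by (subst cInf_less_iff[symmetric]) (use bdd in auto)
    then show ?thesis by auto
  qed
  then obtain y where yK: "\<And>n. y n \<in> K"
    and y: "\<And>n. (norm (x - y n))\<^sup>2 < d + 1 / real (Suc n)"
    by metis
  have close: "(norm (y m - y n))\<^sup>2 \<le> 2 / real (Suc m) + 2 / real (Suc n)" for m n
  proof -
    have mid: "(1/2) *\<^sub>R (y m + y n) \<in> K"
      using K(1) yK by (intro subspace_scale subspace_add)
    have "(norm (y m - y n))\<^sup>2 + 4 * (norm (x - (1/2) *\<^sub>R (y m + y n)))\<^sup>2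
        = 2 * (norm (x - y m))\<^sup>2 + 2 * (norm (x - y n))\<^sup>2"
      unfolding power2_norm_eq_inner
      by (simp add: inner_diff_left inner_diff_right inner_add_left inner_add_right
          inner_commute algebra_simps)
    then show ?thesis
      using d_le[OF mid] y[of m] y[of n] by simp
  qed
  have "Cauchy y"
  proof (rule metric_CauchyI)
    fix e :: real assume "e > 0"
    obtain N where N: "4 / e\<^sup>2 < real N" using reals_Archimedean2 by blast
    have "dist (y m) (y n) < e" if "m \<ge> N" "n \<ge> N" for m n
    proof -
      have N0: "real N > 0" using N \<open>e > 0\<close> by (smt (verit) divide_pos_pos zero_less_power)
      have a: "1 / real (Suc k) < 1 / real N" if "k \<ge> N" for k
        using that N0 by (intro divide_strict_left_mono) auto
      have "(norm (y m - y n))\<^sup>2 < 4 / real N"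
        using close[of m n] a[OF that(1)] a[OF that(2)] by simp
      also have "\<dots> < e\<^sup>2"
        using N N0 \<open>e > 0\<close> by (simp add: field_simps)
      finally show ?thesis
        using \<open>e > 0\<close> by (simp add: dist_norm power2_less_imp_less)
    qed
    then show "\<exists>M. \<forall>m\<ge>M. \<forall>n\<ge>M. dist (y m) (y n) < e" by blast
  qed
  then obtain p where p: "y \<longlonglongrightarrow> p"
    using Cauchy_convergent convergent_def by blast
  have pK: "p \<in> K"
    using K(2) yK p closed_sequentially by blast
  have "(norm (x - p))\<^sup>2 \<le> d"
  proof (rule LIMSEQ_le)
    show "(\<lambda>n. (norm (x - y n))\<^sup>2) \<longlonglongrightarrow> (norm (x - p))\<^sup>2"
      by (intro tendsto_intros p)
    show "(\<lambda>n. d + 1 / real (Suc n)) \<longlonglongrightarrow> d"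
      using tendsto_add[OF tendsto_const LIMSEQ_inverse_real_of_nat, of d]
      by (simp add: inverse_eq_divide)
    show "\<exists>N. \<forall>n\<ge>N. (norm (x - y n))\<^sup>2 \<le> d + 1 / real (Suc n)"
      using y less_imp_le by blast
  qed
  then have min: "(norm (x - p))\<^sup>2 \<le> (norm (x - q))\<^sup>2" if "q \<in> K" for q
    using d_le[OF that] by linarith
  have "inner (x - p) z = 0" if z: "z \<in> K" for z
  proof (cases "z = 0")
    case False
    \<comment> \<open>This \<open>t\<close> minimises the quadratic polynomial that compares the
      distances of \<open>p\<close> and \<open>p + t *\<^sub>R z\<close> from
      \<open>x\<close>.\<close>
    define t where "t = inner (x - p) z / inner z z"
    have "p + t *\<^sub>R z \<in> K"
      using K(1) pK z by (intro subspace_add subspace_scale)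
    from min[OF this] have "0 \<le> - 2 * t * inner (x - p) z + t\<^sup>2 * inner z z"
      unfolding power2_norm_eq_inner
      by (simp add: inner_diff_left inner_diff_right inner_add_left inner_add_right
          inner_commute algebra_simps power2_eq_square)
    also have "\<dots> = - (inner (x - p) z)\<^sup>2 / inner z z"
      using False by (simp add: t_def field_simps power2_eq_square)
    finally have "(inner (x - p) z)\<^sup>2 / inner z z \<le> 0" by simp
    moreover have "inner z z > 0" using False by simp
    ultimately have "(inner (x - p) z)\<^sup>2 \<le> 0"
      by (metis divide_le_0_iff not_le order.refl)
    then show ?thesis by simp
  qed simp
  with pK show ?thesis by blast
qed

section \<open>Square roots and absolute values of operators by iteration\<close>

text \<open>The iteration \<open>Z \<mapsto> (X + Z\<^sup>2) / 2\<close> converges to a solution of \<open>(1 - Z)\<^sup>2 = 1 - X\<close>; its increments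
  are dominated by those of the scalar iteration with \<open>X = 1\<close>.\<close>

primrec sqrt_iter :: "('a::real_vector \<Rightarrow> 'a) \<Rightarrow> nat \<Rightarrow> 'a \<Rightarrow> 'a" where
  "sqrt_iter X 0 x = 0"
| "sqrt_iter X (Suc n) x = (1/2) *\<^sub>R (X x + sqrt_iter X n (sqrt_iter X n x))"

primrec sqrt_iter_bound :: "nat \<Rightarrow> real" where
  "sqrt_iter_bound 0 = 0"
| "sqrt_iter_bound (Suc n) = (1 + (sqrt_iter_bound n)\<^sup>2) / 2"

lemma sqrt_iter_bound_range: "0 \<le> sqrt_iter_bound n \<and> sqrt_iter_bound n \<le> 1"
proof (induction n)
  case (Suc n)
  then have "(sqrt_iter_bound n)\<^sup>2 \<le> 1" by (simp add: power_le_one)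
  then show ?case by simp
qed simp

lemma sqrt_iter_bound_mono: "sqrt_iter_bound n \<le> sqrt_iter_bound (Suc n)"
  using sum_power2_ge_zero[of "sqrt_iter_bound n - 1" 0]
  by (simp add: power2_eq_square algebra_simps)

lemma linear_sqrt_iter: "linear X \<Longrightarrow> linear (sqrt_iter X n)"
  by (induction n) (auto intro!: linearI simp: linear_add linear_scale algebra_simps)

lemma sqrt_iter_commute:
  assumes "linear T" and "\<And>x. T (X x) = X (T x)"
  shows "T (sqrt_iter X n x) = sqrt_iter X n (T x)"
  by (induction n arbitrary: x) (auto simp: assms linear_add linear_scale linear_0)

lemma norm_sqrt_iter_le:
  fixes X :: "'a::real_normed_vector \<Rightarrow> 'a"
  assumes "\<And>x. norm (X x) \<le> norm x"
  shows "norm (sqrt_iter X n x) \<le> sqrt_iter_bound n * norm x"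
proof (induction n arbitrary: x)
  case (Suc n)
  have "norm (sqrt_iter X n (sqrt_iter X n x)) \<le> sqrt_iter_bound n * norm (sqrt_iter X n x)"
    by (rule Suc)
  also have "\<dots> \<le> sqrt_iter_bound n * (sqrt_iter_bound n * norm x)"
    by (intro mult_left_mono Suc) (use sqrt_iter_bound_range in auto)
  finally show ?case
    using norm_triangle_ineq[of "X x" "sqrt_iter X n (sqrt_iter X n x)"] assms[of x]
    by (simp add: power2_eq_square mult_ac distrib_left)
qed simp

text \<open>The iterates are polynomials in \<open>X\<close>, so they commute and the difference of
  the squares of two consecutive ones factors into difference times sum. The induction hypothesis is
  applied at the vector \<open>u\<close>, the sum evaluated at \<open>x\<close>; the scalar bounds
  factor in the same way, so the estimate closes exactly.\<close>

lemma norm_sqrt_iter_diff_le: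
  fixes X :: "'a::real_normed_vector \<Rightarrow> 'a"
  assumes X: "linear X" "\<And>x. norm (X x) \<le> norm x"
  shows "norm (sqrt_iter X (Suc n) x - sqrt_iter X n x)
    \<le> (sqrt_iter_bound (Suc n) - sqrt_iter_bound n) * norm x"
proof (induction n arbitrary: x)
  case 0
  then show ?case using X(2)[of x] by simp
next
  case (Suc n)
  let ?Z = "sqrt_iter X" and ?z = sqrt_iter_bound
  have comm: "?Z m (?Z k y) = ?Z k (?Z m y)" for m k y
    by (intro sqrt_iter_commute linear_sqrt_iter X)
       (simp add: sqrt_iter_commute[OF X(1)])
  define u where "u = ?Z (Suc n) x + ?Z n x"
  have "?Z (Suc (Suc n)) x - ?Z (Suc n) x
      = (1/2) *\<^sub>R (?Z (Suc n) (?Z (Suc n) x) - ?Z n (?Z n x))"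
    by (simp only: sqrt_iter.simps(2)[of X "Suc n"] sqrt_iter.simps(2)[of X n x])
       (simp add: algebra_simps)
  also have "\<dots> = (1/2) *\<^sub>R (?Z (Suc n) u - ?Z n u)"
    unfolding u_def using comm[of "Suc n" n x]
    by (simp only: linear_add[OF linear_sqrt_iter[OF X(1)]]) (simp add: algebra_simps)
  finally have "norm (?Z (Suc (Suc n)) x - ?Z (Suc n) x) = norm (?Z (Suc n) u - ?Z n u) / 2"
    by simp
  also have "\<dots> \<le> (?z (Suc n) - ?z n) * norm u / 2"
    using Suc[of u] by simp
  also have "\<dots> \<le> (?z (Suc n) - ?z n) * ((?z (Suc n) + ?z n) * norm x) / 2"
  proof -
    have "norm u \<le> (?z (Suc n) + ?z n) * norm x"
      unfolding u_def
      using norm_triangle_ineq[of "?Z (Suc n) x" "?Z n x"]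
        norm_sqrt_iter_le[OF X(2), of "Suc n" x] norm_sqrt_iter_le[OF X(2), of n x]
      by (simp only: distrib_right)
    then show ?thesis
      using sqrt_iter_bound_mono[of n] by (intro divide_right_mono mult_left_mono) auto
  qed
  also have "\<dots> = (?z (Suc (Suc n)) - ?z (Suc n)) * norm x"
    by (simp only: sqrt_iter_bound.simps(2)[of "Suc n"] sqrt_iter_bound.simps(2)[of n])
       (simp add: power2_eq_square field_simps)
  finally show ?case .
qed

text \<open>The increments telescope against the scalar sequence, which is increasing and bounded by
  1, hence Cauchy.\<close>

lemma Cauchy_sqrt_iter:
  fixes X :: "'a::real_normed_vector \<Rightarrow> 'a"
  assumes X: "linear X" "\<And>x. norm (X x) \<le> norm x"
  shows "Cauchy (\<lambda>n. sqrt_iter X n x)"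
proof -
  let ?Z = "\<lambda>n. sqrt_iter X n x" and ?z = sqrt_iter_bound
  have diff: "norm (?Z (m + k) - ?Z m) \<le> (?z (m + k) - ?z m) * norm x" for m k
  proof (induction k)
    case (Suc k)
    then show ?case
      using norm_sqrt_iter_diff_le[OF X, of "m + k" x]
        norm_triangle_ineq[of "?Z (Suc (m + k)) - ?Z (m + k)" "?Z (m + k) - ?Z m"]
      unfolding add_Suc_right left_diff_distrib diff_add_cancel
      by (simp del: sqrt_iter.simps sqrt_iter_bound.simps)
  qed simp
  have "incseq ?z" by (intro incseq_SucI sqrt_iter_bound_mono)
  then have "convergent ?z"
    using sqrt_iter_bound_range by (intro Bseq_monoseq_convergent BseqI'[of _ 1])
      (auto simp: abs_le_iff incseq_imp_monoseq intro: order_trans[of _ 0])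
  then have Cz: "Cauchy ?z" by (rule convergent_Cauchy)
  show ?thesis
  proof (rule metric_CauchyI)
    fix e :: real assume "e > 0"
    then have "e / (norm x + 1) > 0" by (simp add: add_nonneg_pos)
    then obtain N where N: "\<And>m n. m \<ge> N \<Longrightarrow> n \<ge> N \<Longrightarrow> dist (?z m) (?z n) < e / (norm x + 1)"
      using Cz metric_CauchyD by metis
    have *: "norm (?Z (m + k) - ?Z m) < e" if "m \<ge> N" for m k
    proof -
      have "\<bar>?z (m + k) - ?z m\<bar> < e / (norm x + 1)"
        using N[of "m + k" m] that by (simp add: dist_real_def)
      then have "?z (m + k) - ?z m \<le> e / (norm x + 1)" by simp
      then have "(?z (m + k) - ?z m) * norm x \<le> e / (norm x + 1) * norm x"
        by (rule mult_right_mono) simp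
      also have "\<dots> < e"
        using \<open>e > 0\<close> by (simp add: pos_divide_less_eq add_nonneg_pos)
      finally show ?thesis using diff[of m k] by linarith
    qed
    have "dist (?Z m) (?Z n) < e" if "m \<ge> N" "n \<ge> N" for m n
    proof (cases "m \<le> n")
      case True
      then show ?thesis using *[OF that(1), of "n - m"] by (simp add: dist_norm norm_minus_commute)
    next
      case False
      then show ?thesis using *[OF that(2), of "m - n"] by (simp add: dist_norm)
    qed
    then show "\<exists>M. \<forall>m\<ge>M. \<forall>n\<ge>M. dist (?Z m) (?Z n) < e" by blast
  qed
qed

text \<open>\<open>Z\<close> plays the role of 1 - sqrt(1 - X), described by the fixed-point
  equation of the iteration. An operator commuting with \<open>X\<close> commutes with every
  iterate, and its continuity carries this to the limit.\<close>

lemma ex_one_minus_sqrt: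
  fixes X :: "'a::{real_normed_vector,complete_space} \<Rightarrow> 'a"
  assumes X: "linear X" "\<And>x. norm (X x) \<le> norm x"
  obtains Z where "linear Z" "\<And>x. norm (Z x) \<le> norm x" "\<And>x. X x + Z (Z x) = 2 *\<^sub>R Z x"
    "\<And>T x. bounded_linear T \<Longrightarrow> (\<And>y. T (X y) = X (T y)) \<Longrightarrow> T (Z x) = Z (T x)"
proof
  define Z where "Z = (\<lambda>x. lim (\<lambda>n. sqrt_iter X n x))"
  have Z: "(\<lambda>n. sqrt_iter X n x) \<longlonglongrightarrow> Z x" for x
    unfolding Z_def using Cauchy_sqrt_iter[OF X] Cauchy_convergent convergent_LIMSEQ_iff by blast
  have lin: "linear (sqrt_iter X n)" for n by (rule linear_sqrt_iter[OF X(1)])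
  show "linear Z"
  proof (rule linearI)
    fix x y :: 'a and r :: real
    have "(\<lambda>n. sqrt_iter X n (x + y)) \<longlonglongrightarrow> Z x + Z y"
      unfolding linear_add[OF lin] by (intro tendsto_add Z)
    then show "Z (x + y) = Z x + Z y" using Z LIMSEQ_unique by blast
    have "(\<lambda>n. sqrt_iter X n (r *\<^sub>R x)) \<longlonglongrightarrow> r *\<^sub>R Z x"
      unfolding linear_scale[OF lin] by (intro tendsto_scaleR tendsto_const Z)
    then show "Z (r *\<^sub>R x) = r *\<^sub>R Z x" using Z LIMSEQ_unique by blast
  qed
  have nz: "norm (sqrt_iter X n x) \<le> norm x" for n x
    using norm_sqrt_iter_le[OF X(2), of n x] sqrt_iter_bound_range[of n]
      mult_right_mono[of "sqrt_iter_bound n" 1 "norm x"] by simp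
  show "norm (Z x) \<le> norm x" for x
    by (rule tendsto_upperbound[OF tendsto_norm[OF Z]]) (use nz in auto)
  show "T (Z x) = Z (T x)"
    if T: "bounded_linear T" and c: "\<And>y. T (X y) = X (T y)" for T x
  proof -
    have "(\<lambda>n. T (sqrt_iter X n x)) \<longlonglongrightarrow> T (Z x)"
      by (rule bounded_linear.tendsto[OF T Z])
    then have "(\<lambda>n. sqrt_iter X n (T x)) \<longlonglongrightarrow> T (Z x)"
      using sqrt_iter_commute[of T X] bounded_linear.linear[OF T] c by simp
    then show ?thesis using Z LIMSEQ_unique by blast
  qed
  show "X x + Z (Z x) = 2 *\<^sub>R Z x" for x
  proof -
    \<comment> \<open>Operator and argument both vary with \<open>n\<close>; as the iterates are
      contractions, the argument may be replaced by its limit \<open>Z x\<close>.\<close>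
    have "(\<lambda>n. sqrt_iter X n (sqrt_iter X n x) - sqrt_iter X n (Z x)) \<longlonglongrightarrow> 0"
    proof (rule tendsto_norm_zero_cancel, rule tendsto_sandwich[OF _ _ tendsto_const])
      show "(\<lambda>n. norm (sqrt_iter X n x - Z x)) \<longlonglongrightarrow> 0"
        using Z LIM_zero tendsto_norm_zero by blast
      show "\<forall>\<^sub>F n in sequentially. norm (sqrt_iter X n (sqrt_iter X n x) - sqrt_iter X n (Z x))
          \<le> norm (sqrt_iter X n x - Z x)"
        using nz by (simp flip: linear_diff[OF lin])
    qed auto
    from tendsto_add[OF this Z[of "Z x"]]
    have "(\<lambda>n. sqrt_iter X n (sqrt_iter X n x)) \<longlonglongrightarrow> Z (Z x)" by simp
    then have "(\<lambda>n. sqrt_iter X (Suc n) x) \<longlonglongrightarrow> (1/2) *\<^sub>R (X x + Z (Z x))"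
      unfolding sqrt_iter.simps by (intro tendsto_intros)
    moreover have "(\<lambda>n. sqrt_iter X (Suc n) x) \<longlonglongrightarrow> Z x"
      using Z by (rule LIMSEQ_Suc)
    ultimately have "(1/2) *\<^sub>R (X x + Z (Z x)) = Z x" using LIMSEQ_unique by blast
    then have "2 *\<^sub>R ((1/2) *\<^sub>R (X x + Z (Z x))) = 2 *\<^sub>R Z x" by (simp only:)
    then show ?thesis by simp
  qed
qed

text \<open>Once \<open>C\<close> is scaled to a contraction \<open>D\<close>, the operator X = 1 -
  D^2 is a contraction too, and 1 - Z is a square root of D^2. Since \<open>Z\<close> commutes with
  everything that commutes with \<open>X\<close>, the operator \<open>S\<close> commutes with
  everything that commutes with \<open>C\<close>.\<close>

lemma ex_absolute_value:
  fixes C :: "'a::{real_inner,complete_space} \<Rightarrow> 'a"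
  assumes C: "bounded_linear C" and sym: "\<And>x y. inner (C x) y = inner x (C y)"
  obtains S where "bounded_linear S" "\<And>x. S (S x) = C (C x)" "\<And>x. inner (S x) x \<ge> 0"
    "\<And>T x. bounded_linear T \<Longrightarrow> (\<And>y. T (C y) = C (T y)) \<Longrightarrow> T (S x) = S (T x)"
proof -
  obtain k where k: "k > 0" "\<And>x. norm (C x) \<le> norm x * k"
    using bounded_linear.pos_bounded[OF C] by blast
  note lin = bounded_linear.linear[OF C]
  define D where "D x = (1/k) *\<^sub>R C x" for x
  define X where "X x = x - D (D x)" for x
  have linD: "linear D" unfolding D_def
    by (intro linearI) (simp_all add: linear_add[OF lin] linear_scale[OF lin] algebra_simps)
  have linX: "linear X" unfolding X_def
    by (intro linearI) (simp_all add: linear_add[OF linD] linear_scale[OF linD] algebra_simps)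
  have symD: "inner (D x) y = inner x (D y)" for x y
    unfolding D_def by (simp add: sym)
  have nD: "norm (D x) \<le> norm x" for x
    using k by (simp add: D_def field_simps)
  have nX: "norm (X x) \<le> norm x" for x
  proof -
    \<comment> \<open>Symmetry of \<open>D\<close> turns the cross term into minus twice the square
      of \<open>norm (D x)\<close>, which outweighs the last term.\<close>
    have "(norm (X x))\<^sup>2 = (norm x)\<^sup>2 - 2 * (norm (D x))\<^sup>2 + (norm (D (D x)))\<^sup>2"
      unfolding X_def power2_norm_eq_inner
      using symD[of x "D x"] by (simp add: inner_diff_left inner_diff_right inner_commute)
    also have "\<dots> \<le> (norm x)\<^sup>2"
      using power_mono[OF nD[of "D x"] norm_ge_zero, of 2] zero_le_power2[of "norm (D x)"]
      by linarith
    finally show ?thesis by (rule power2_le_imp_le) simp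
  qed
  obtain Z where Z: "linear Z" "\<And>x. norm (Z x) \<le> norm x"
    "\<And>x. X x + Z (Z x) = 2 *\<^sub>R Z x"
    "\<And>T x. bounded_linear T \<Longrightarrow> (\<And>y. T (X y) = X (T y)) \<Longrightarrow> T (Z x) = Z (T x)"
    by (fact ex_one_minus_sqrt[OF linX nX])
  define S where "S x = k *\<^sub>R (x - Z x)" for x
  have blZ: "bounded_linear Z"
    using Z(1,2) by (intro bounded_linear_intro[where K=1]) (auto simp: linear_add linear_scale)
  show ?thesis
  proof
    show "bounded_linear S"
      unfolding S_def by (intro bounded_linear_intros blZ)
    fix x
    have "x - Z x - Z (x - Z x) = D (D x)"
      using Z(3)[of x] unfolding X_def linear_diff[OF Z(1)] scaleR_2 by (simp add: algebra_simps)
    then have "S (S x) = (k * k) *\<^sub>R D (D x)"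
      unfolding S_def linear_scale[OF Z(1)] by (simp flip: scaleR_diff_right)
    then show "S (S x) = C (C x)"
      using k(1) by (simp add: D_def linear_scale[OF lin])
    have "inner (Z x) x \<le> inner x x"
      using norm_cauchy_schwarz[of "Z x" x] mult_right_mono[OF Z(2)[of x] norm_ge_zero[of x]]
      by (simp add: norm_eq_sqrt_inner)
    then show "inner (S x) x \<ge> 0"
      unfolding S_def using k(1) by (simp add: inner_diff_left)
  next
    fix T x assume T: "bounded_linear T" and c: "\<And>y. T (C y) = C (T y)"
    note linT = bounded_linear.linear[OF T]
    have "T (X y) = X (T y)" for y
      unfolding X_def D_def by (simp add: linear_diff[OF linT] linear_scale[OF linT] c linear_scale[OF lin])
    from Z(4)[OF T this] show "T (S x) = S (T x)"
      unfolding S_def by (simp add: linear_scale[OF linT] linear_diff[OF linT])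
  qed
qed

text \<open>\<open>M\<close> is the kernel of \<open>\<bar>C\<bar> - C\<close>; it contains the range of \<open>\<bar>C\<bar> + C\<close>.\<close>

lemma ex_positive_spectral_subspace:
  fixes C :: "'a::{real_inner,complete_space} \<Rightarrow> 'a"
  assumes C: "bounded_linear C" and sym: "\<And>x y. inner (C x) y = inner x (C y)"
    and pos: "inner (C x\<^sub>0) x\<^sub>0 > 0"
  obtains M where "closed M" "subspace M" "M \<noteq> {0}" "\<And>w. w \<in> M \<Longrightarrow> inner (C w) w \<ge> 0"
    "\<And>T w. bounded_linear T \<Longrightarrow> (\<And>y. T (C y) = C (T y)) \<Longrightarrow> w \<in> M \<Longrightarrow> T w \<in> M"
proof -
  obtain S where S: "bounded_linear S"
    "\<And>x. S (S x) = C (C x)" "\<And>x. inner (S x) x \<ge> 0"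
    "\<And>T x. bounded_linear T \<Longrightarrow> (\<And>y. T (C y) = C (T y)) \<Longrightarrow> T (S x) = S (T x)"
    by (fact ex_absolute_value[OF C sym])
  note lin = bounded_linear.linear[OF C] bounded_linear.linear[OF S(1)]
  define M where "M = {w. S w = C w}"
  show ?thesis
  proof
    show "closed M" unfolding M_def
      by (intro closed_Collect_eq linear_continuous_on C S(1))
    show "subspace M" unfolding M_def subspace_def
      by (auto simp: lin[THEN linear_add] lin[THEN linear_scale] lin[THEN linear_0])
    show "inner (C w) w \<ge> 0" if "w \<in> M" for w
      using that S(3)[of w] by (simp add: M_def)
    show "T w \<in> M" if "bounded_linear T" "\<And>y. T (C y) = C (T y)" "w \<in> M" for T w
      using that S(4)[of T w] by (simp add: M_def)
    show "M \<noteq> {0}"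
    proof
      assume "M = {0}"
      \<comment> \<open>(S - C)(S + C) = S^2 - C^2 = 0, because \<open>S\<close> commutes with
        \<open>C\<close>.\<close>
      moreover have "S x\<^sub>0 + C x\<^sub>0 \<in> M"
        unfolding M_def using S(2) S(4)[OF C]
        by (simp add: lin[THEN linear_add])
      ultimately have "S x\<^sub>0 = - C x\<^sub>0" by (simp add: eq_neg_iff_add_eq_0)
      with S(3)[of x\<^sub>0] pos show False by simp
    qed
  qed
qed

subsection \<open>Projections and unitary representations on complex Hilbert spaces\<close>

lemma cinner_scaleC_right: "cinner x (c *\<^sub>C y) = cnj c * cinner x y"
  by (metis cinner_commute cinner_scaleC_left complex_cnj_mult)

lemma scaleC_minus1: "(- 1) *\<^sub>C x = - x" for x :: "'a::complex_inner"
  using scaleC_of_real[of "-1" x] by simp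

lemma cinner_minus_left: "cinner (- x) y = - cinner x y"
  using cinner_scaleC_left[of "-1" x y] by (simp add: scaleC_minus1)

lemma cinner_diff_left: "cinner (x - y) z = cinner x z - cinner y z"
  using cinner_add_left[of x "- y" z] by (simp add: cinner_minus_left)

lemma cinner_diff_right: "cinner x (y - z) = cinner x y - cinner x z"
  by (metis cinner_diff_left cinner_commute complex_cnj_diff)

lemma cinner_zero_left [simp]: "cinner 0 x = 0"
  using cinner_diff_left[of x x x] by simp

lemma cinner_zero_right [simp]: "cinner x 0 = 0"
  using cinner_diff_right[of x x x] by simp

lemma cinner_self_eq_0: "cinner x x = 0 \<longleftrightarrow> x = 0"
  by (simp add: cinner_self)

lemma csubspace_imp_subspace:
  assumes "csubspace K" shows "subspace K"
  using assms complex_vector.subspace_scale[OF assms]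
  unfolding complex_vector.subspace_def subspace_def by (metis scaleC_of_real)

text \<open>Testing against \<open>\<i> *\<^sub>C z\<close> as well as \<open>z\<close> recovers the
  imaginary part, so the real projection theorem serves complex subspaces.\<close>

lemma cinner_eq_0_if_inner_eq_0:
  assumes K: "csubspace K" and x: "\<And>z. z \<in> K \<Longrightarrow> inner x z = 0" and z: "z \<in> K"
  shows "cinner x z = 0"
proof -
  have "\<i> *\<^sub>C z \<in> K" using complex_vector.subspace_scale[OF K z] .
  then have "Re (cinner x (\<i> *\<^sub>C z)) = 0" using x by (simp add: Re_cinner)
  then have "Im (cinner x z) = 0" by (simp add: cinner_scaleC_right)
  then show ?thesis using x[OF z] by (simp add: complex_eq_iff Re_cinner)
qed

lemma orth_proj_eqI:
  assumes K: "csubspace K" and y: "y \<in> K" "\<And>z. z \<in> K \<Longrightarrow> cinner (x - y) z = 0"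
  shows "orth_proj K x = y"
  unfolding orth_proj_def
proof (rule the_equality)
  fix y' assume y': "y' \<in> K \<and> (\<forall>z\<in>K. cinner (x - y') z = 0)"
  then have d: "y' - y \<in> K" using complex_vector.subspace_diff[OF K] y(1) by blast
  have "cinner (y' - y) (y' - y) = cinner (x - y) (y' - y) - cinner (x - y') (y' - y)"
    by (simp add: cinner_diff_left)
  also have "\<dots> = 0" using y(2)[OF d] y' d by simp
  finally show "y' = y" by (simp add: cinner_self_eq_0)
qed (use y in auto)

context
  fixes K :: "'a::complex_hilbert set"
  assumes K: "csubspace K" "closed K"
begin

lemma orth_proj_properties:
  shows orth_proj_in: "orth_proj K x \<in> K"
    and orth_proj_orth: "z \<in> K \<Longrightarrow> cinner (x - orth_proj K x) z = 0"
proof -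
  from ex_orthogonal_projection[OF csubspace_imp_subspace[OF K(1)] K(2), of x]
  obtain y where y: "y \<in> K" "\<And>z. z \<in> K \<Longrightarrow> inner (x - y) z = 0" by blast
  then have *: "cinner (x - y) z = 0" if "z \<in> K" for z
    using cinner_eq_0_if_inner_eq_0[OF K(1)] that by blast
  have "orth_proj K x = y" by (rule orth_proj_eqI[OF K(1) y(1) *])
  then show "orth_proj K x \<in> K" "z \<in> K \<Longrightarrow> cinner (x - orth_proj K x) z = 0"
    using y(1) * by auto
qed

lemma orth_proj_id: "x \<in> K \<Longrightarrow> orth_proj K x = x"
  by (rule orth_proj_eqI[OF K(1)]) auto

lemma orth_proj_add: "orth_proj K (x + y) = orth_proj K x + orth_proj K y"
proof (rule orth_proj_eqI[OF K(1)])
  fix z assume "z \<in> K"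
  then have "cinner ((x - orth_proj K x) + (y - orth_proj K y)) z = 0"
    by (simp only: cinner_add_left orth_proj_orth) simp
  then show "cinner (x + y - (orth_proj K x + orth_proj K y)) z = 0"
    by (simp add: algebra_simps)
qed (intro complex_vector.subspace_add K orth_proj_in)

lemma orth_proj_scaleC: "orth_proj K (c *\<^sub>C x) = c *\<^sub>C orth_proj K x"
proof (rule orth_proj_eqI[OF K(1)])
  fix z assume "z \<in> K"
  then have "cinner (c *\<^sub>C (x - orth_proj K x)) z = 0"
    by (simp only: cinner_scaleC_left orth_proj_orth) simp
  then show "cinner (c *\<^sub>C x - c *\<^sub>C orth_proj K x) z = 0"
    by (simp add: complex_vector.scale_right_diff_distrib)
qed (intro complex_vector.subspace_scale K orth_proj_in)

lemma orth_proj_eq_0_iff: "orth_proj K x = 0 \<longleftrightarrow> (\<forall>z\<in>K. cinner x z = 0)"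
proof
  assume "orth_proj K x = 0"
  then show "\<forall>z\<in>K. cinner x z = 0" using orth_proj_orth[of _ x] by simp
next
  assume "\<forall>z\<in>K. cinner x z = 0"
  then show "orth_proj K x = 0"
    by (intro orth_proj_eqI K) (auto intro: complex_vector.subspace_0 K)
qed

lemma cinner_orth_proj_left: "z \<in> K \<Longrightarrow> cinner (orth_proj K x) z = cinner x z"
  using orth_proj_orth[of z x] by (simp add: cinner_diff_left)

lemma cinner_orth_proj_swap: "cinner (orth_proj K x) y = cinner x (orth_proj K y)"
  by (metis cinner_orth_proj_left cinner_commute orth_proj_in)

lemma inner_orth_proj_swap: "inner (orth_proj K x) y = inner x (orth_proj K y)"
  by (metis cinner_orth_proj_swap Re_cinner)

lemma inner_orth_proj_left: "z \<in> K \<Longrightarrow> inner (orth_proj K x) z = inner x z"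
  by (metis cinner_orth_proj_left Re_cinner)

lemma norm_orth_proj_le: "norm (orth_proj K x) \<le> norm x"
proof -
  have "(norm (orth_proj K x))\<^sup>2 = inner x (orth_proj K x)"
    using inner_orth_proj_left[OF orth_proj_in] by (simp add: power2_norm_eq_inner)
  also have "\<dots> \<le> norm x * norm (orth_proj K x)" by (rule norm_cauchy_schwarz)
  finally show ?thesis
    by (cases "norm (orth_proj K x) = 0") (auto simp: power2_eq_square)
qed

lemma bounded_linear_orth_proj: "bounded_linear (orth_proj K)"
  by (rule bounded_linear_intro[where K=1])
     (auto simp: orth_proj_add norm_orth_proj_le orth_proj_scaleC simp flip: scaleC_of_real)

lemma orth_proj_diff: "orth_proj K (x - y) = orth_proj K x - orth_proj K y"
  using linear_diff[OF bounded_linear.linear[OF bounded_linear_orth_proj]] .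

text \<open>A Lax-Milgram argument: coercivity bounds \<open>Q\<close> from below on
  \<open>K\<close>, so \<open>Q\<close> is injective there with complete range; a vector of
  \<open>K\<close> orthogonal to the range is orthogonal to its own image and hence zero.\<close>

lemma bij_betw_if_coercive:
  assumes Q: "bounded_linear Q" "Q ` K \<subseteq> K" and \<delta>: "\<delta> > 0" "\<And>w. w \<in> K \<Longrightarrow> \<delta> * (norm w)\<^sup>2 \<le> inner (Q w) w"
    and Qc: "\<And>c x. Q (c *\<^sub>C x) = c *\<^sub>C Q x"
  shows "bij_betw Q K K"
proof -
  note lin = bounded_linear.linear[OF Q(1)]
  have lower: "\<delta> * norm w \<le> norm (Q w)" if "w \<in> K" for w
  proof (cases "w = 0")
    case False
    have "\<delta> * (norm w)\<^sup>2 \<le> norm (Q w) * norm w"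
      using \<delta>(2)[OF that] norm_cauchy_schwarz[of "Q w" w] by linarith
    then show ?thesis using False by (simp add: power2_eq_square)
  qed simp
  have "inj_on Q K"
  proof (rule inj_onI)
    fix x y assume xy: "x \<in> K" "y \<in> K" "Q x = Q y"
    then have "\<delta> * norm (x - y) \<le> 0"
      using lower[of "x - y"] complex_vector.subspace_diff[OF K(1)] by (simp add: linear_diff[OF lin])
    then show "x = y" using \<delta>(1) by (simp add: mult_le_0_iff)
  qed
  moreover have "K \<subseteq> Q ` K"
  proof
    fix y assume y: "y \<in> K"
    have sub: "csubspace (Q ` K)"
      unfolding complex_vector.subspace_def
    proof (intro conjI ballI allI)
      show "0 \<in> Q ` K"
        using complex_vector.subspace_0[OF K(1)] linear_0[OF lin] by (metis image_eqI)
      fix u v assume "u \<in> Q ` K" "v \<in> Q ` K"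
      then show "u + v \<in> Q ` K"
        using complex_vector.subspace_add[OF K(1)] by (auto simp flip: linear_add[OF lin])
    next
      fix c u assume "u \<in> Q ` K"
      then show "c *\<^sub>C u \<in> Q ` K"
        using complex_vector.subspace_scale[OF K(1)] by (auto simp flip: Qc)
    qed
    have "complete (Q ` K)"
      by (rule complete_isometric_image[OF \<delta>(1) csubspace_imp_subspace[OF K(1)] Q(1)])
         (use lower K(2) in \<open>auto simp: complete_eq_closed\<close>)
    then have clo: "closed (Q ` K)" by (simp add: complete_eq_closed)
    from ex_orthogonal_projection[OF csubspace_imp_subspace[OF sub] clo, of y]
    obtain p where p: "p \<in> Q ` K" "\<And>z. z \<in> Q ` K \<Longrightarrow> inner (y - p) z = 0" by blast
    have "y - p \<in> K" using p(1) y Q(2) complex_vector.subspace_diff[OF K(1)] by blast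
    from \<delta>(2)[OF this] p(2)[of "Q (y - p)"] this have "\<delta> * (norm (y - p))\<^sup>2 \<le> 0"
      by (simp add: inner_commute)
    then have "y = p" using \<delta>(1) by (simp add: mult_le_0_iff)
    then show "y \<in> Q ` K" using p(1) by simp
  qed
  ultimately show ?thesis using Q(2) by (auto simp: bij_betw_def)
qed

text \<open>The adjoint \<open>v \<mapsto> orth_proj K (\<iota> v)\<close> of \<open>f\<close>, restricted to \<open>K\<close>, is invertible because its composition
  with \<open>f\<close> is coercive.\<close>

lemma bij_betw_restricted_adjoint:
  fixes f :: "'a \<Rightarrow> 'c::complex_hilbert" and \<iota> :: "'c \<Rightarrow> 'a"
  assumes f: "bounded_linear f" "\<And>c x. f (c *\<^sub>C x) = c *\<^sub>C f x"
    and \<iota>: "bounded_linear \<iota>" "\<And>c x. \<iota> (c *\<^sub>C x) = c *\<^sub>C \<iota> x" "\<And>v w. inner (\<iota> v) w = inner v (f w)"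
    and \<delta>: "\<delta> > 0" "\<And>w. w \<in> K \<Longrightarrow> \<delta> * norm w \<le> norm (f w)"
  shows "closed (f ` K)" "csubspace (f ` K)" "bij_betw (\<lambda>v. orth_proj K (\<iota> v)) (f ` K) K"
    "v \<in> f ` K \<Longrightarrow> \<delta> * norm v \<le> norm (orth_proj K (\<iota> v))"
proof -
  note lin = bounded_linear.linear[OF f(1)]
  let ?J = "\<lambda>v. orth_proj K (\<iota> v)" and ?Q = "\<lambda>w. orth_proj K (\<iota> (f w))"
  have "complete (f ` K)"
    by (rule complete_isometric_image[OF \<delta>(1) csubspace_imp_subspace[OF K(1)] f(1)])
       (use \<delta>(2) K(2) in \<open>auto simp: complete_eq_closed\<close>)
  then show "closed (f ` K)" by (simp add: complete_eq_closed)
  show "csubspace (f ` K)"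
    unfolding complex_vector.subspace_def
  proof (intro conjI ballI allI)
    show "0 \<in> f ` K"
      using complex_vector.subspace_0[OF K(1)] linear_0[OF lin] by (metis image_eqI)
    fix u v assume "u \<in> f ` K" "v \<in> f ` K"
    then show "u + v \<in> f ` K"
      using complex_vector.subspace_add[OF K(1)] by (auto simp flip: linear_add[OF lin])
  next
    fix c u assume "u \<in> f ` K"
    then show "c *\<^sub>C u \<in> f ` K"
      using complex_vector.subspace_scale[OF K(1)] by (auto simp flip: f(2))
  qed
  \<comment> \<open>On \<open>K\<close>, \<open>?Q\<close> is the compression of the adjoint of
    \<open>f\<close> composed with \<open>f\<close>; hence the coercivity constant
    \<open>\<delta>\<^sup>2\<close> below.\<close>
  have Qw: "inner (?Q w) w = (norm (f w))\<^sup>2" if "w \<in> K" for w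
    using that by (simp add: inner_orth_proj_left \<iota>(3) power2_norm_eq_inner)
  have bij: "bij_betw ?Q K K"
  proof (rule bij_betw_if_coercive)
    show "bounded_linear ?Q"
      by (intro bounded_linear_compose[OF bounded_linear_orth_proj] bounded_linear_compose[OF \<iota>(1)] f(1))
    show "?Q ` K \<subseteq> K" using orth_proj_in by auto
    show "\<delta>\<^sup>2 > 0" using \<delta>(1) by simp
    show "\<delta>\<^sup>2 * (norm w)\<^sup>2 \<le> inner (?Q w) w" if "w \<in> K" for w
      using power_mono[OF \<delta>(2)[OF that], of 2] \<delta>(1) by (simp add: Qw that power_mult_distrib)
  qed (simp add: f(2) \<iota>(2) orth_proj_scaleC)
  then have "inj_on (?J \<circ> f) K" "(?J \<circ> f) ` K = K" by (auto simp: bij_betw_def o_def)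
  then show "bij_betw ?J (f ` K) K"
    by (simp add: bij_betw_def image_comp inj_on_imageI)
  assume "v \<in> f ` K"
  then obtain w where w: "w \<in> K" "v = f w" by blast
  show "\<delta> * norm v \<le> norm (?J v)"
  proof (cases "w = 0")
    case True
    then show ?thesis by (simp add: w linear_0[OF lin])
  next
    case False
    \<comment> \<open>Bounding the form of \<open>?Q\<close> by Cauchy-Schwarz and cancelling
      \<open>norm w\<close> gives the adjoint the same constant \<delta> as
      \<open>f\<close>.\<close>
    have "\<delta> * norm (f w) * norm w \<le> (norm (f w))\<^sup>2"
      using mult_right_mono[OF \<delta>(2)[OF w(1)], of "norm (f w)"] by (simp add: power2_eq_square mult_ac)
    also have "\<dots> \<le> norm (?Q w) * norm w"
      using norm_cauchy_schwarz[of "?Q w" w] by (simp add: Qw w)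
    finally show ?thesis using False by (simp add: w)
  qed
qed

end

section \<open>Unitary representations and their invariant subspaces\<close>

lemma closed_invariant_subspaceD:
  assumes "closed_invariant_subspace \<pi> K"
  shows "csubspace K" "closed K" "x \<in> K \<Longrightarrow> \<pi> g x \<in> K"
  using assms by (auto simp: closed_invariant_subspace_def)

context
  fixes \<pi> :: "'g::topological_group_add \<Rightarrow> 'a::complex_hilbert \<Rightarrow> 'a"
  assumes \<pi>: "unitary_rep \<pi>"
begin

lemma unitary_rep_clinear:
  shows unitary_rep_add: "\<pi> g (x + y) = \<pi> g x + \<pi> g y"
    and unitary_rep_scaleC: "\<pi> g (c *\<^sub>C x) = c *\<^sub>C \<pi> g x"
    and unitary_rep_diff: "\<pi> g (x - y) = \<pi> g x - \<pi> g y"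
proof -
  have "clinear (\<pi> g)" using \<pi> by (simp add: unitary_rep_def unitary_op_def)
  then interpret Vector_Spaces.linear scaleC scaleC "\<pi> g" .
  show "\<pi> g (x + y) = \<pi> g x + \<pi> g y" "\<pi> g (c *\<^sub>C x) = c *\<^sub>C \<pi> g x" "\<pi> g (x - y) = \<pi> g x - \<pi> g y"
    by (simp_all add: add scale diff)
qed

lemma unitary_rep_cinner: "cinner (\<pi> g x) (\<pi> g y) = cinner x y"
  using \<pi> by (simp add: unitary_rep_def unitary_op_def)

lemma unitary_rep_inverse: "\<pi> g (\<pi> (- g) x) = x"
proof -
  have "\<pi> (g + - g) = \<pi> g \<circ> \<pi> (- g)" "\<pi> 0 = id" using \<pi> unfolding unitary_rep_def by blast+
  then show ?thesis by (simp add: fun_eq_iff)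
qed

lemma bounded_linear_unitary_rep: "bounded_linear (\<pi> g)"
proof (rule bounded_linear_intro[where K=1])
  show "norm (\<pi> g x) \<le> norm x * 1" for x
    using arg_cong[OF unitary_rep_cinner[of g x x], of Re]
    by (simp add: Re_cinner norm_eq_sqrt_inner)
qed (simp_all add: unitary_rep_add unitary_rep_scaleC flip: scaleC_of_real)

text \<open>Invariance under \<open>- g\<close> moves the test vector \<open>z\<close> to
  \<open>\<pi> (- g) z\<close> inside \<open>K\<close>; unitarity carries the orthogonality relation
  back.\<close>

lemma orth_proj_unitary_rep:
  assumes K: "closed_invariant_subspace \<pi> K"
  shows "orth_proj K (\<pi> g x) = \<pi> g (orth_proj K x)"
proof (rule orth_proj_eqI)
  note KD = closed_invariant_subspaceD[OF K]
  show "csubspace K" by (rule KD)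
  show "\<pi> g (orth_proj K x) \<in> K" by (intro KD orth_proj_in)
  fix z assume "z \<in> K"
  then have "cinner (x - orth_proj K x) (\<pi> (- g) z) = 0"
    by (intro orth_proj_orth KD)
  then have "cinner (\<pi> g (x - orth_proj K x)) (\<pi> g (\<pi> (- g) z)) = 0"
    by (simp only: unitary_rep_cinner)
  then show "cinner (\<pi> g x - \<pi> g (orth_proj K x)) z = 0"
    by (simp add: unitary_rep_inverse unitary_rep_diff)
qed

lemma closed_invariant_subspace_orth_complement:
  assumes K: "closed_invariant_subspace \<pi> K"
  shows "closed_invariant_subspace \<pi> {w. orth_proj K w = 0}"
  unfolding closed_invariant_subspace_def
proof (intro conjI allI)
  note KD = closed_invariant_subspaceD(1,2)[OF K]
  note lin = bounded_linear_orth_proj[OF KD]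
  show "csubspace {w. orth_proj K w = 0}"
    unfolding complex_vector.subspace_def
    using linear_0[OF bounded_linear.linear[OF lin]]
    by (auto simp: orth_proj_add[OF KD] orth_proj_scaleC[OF KD])
  show "closed {w. orth_proj K w = 0}"
    by (intro closed_Collect_eq linear_continuous_on lin continuous_on_const)
  show "\<pi> g ` {w. orth_proj K w = 0} \<subseteq> {w. orth_proj K w = 0}" for g
    using unitary_rep_zero[OF \<pi>] by (auto simp: orth_proj_unitary_rep[OF K])
qed

end

lemma unitary_rep_direct_sum:
  assumes 1: "unitary_rep \<pi>\<^sub>1" and 2: "unitary_rep \<pi>\<^sub>2"
  shows "unitary_rep (\<pi>\<^sub>1 \<oplus>\<^sub>a \<pi>\<^sub>2)"
proof -
  have "unitary_op ((\<pi>\<^sub>1 \<oplus>\<^sub>a \<pi>\<^sub>2) g)" for g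
    unfolding unitary_op_def
  proof (intro conjI allI)
    show "clinear ((\<pi>\<^sub>1 \<oplus>\<^sub>a \<pi>\<^sub>2) g)"
      by unfold_locales
        (auto simp: direct_sum_action_def scaleC_prod_def unitary_rep_clinear[OF 1] unitary_rep_clinear[OF 2])
    show "surj ((\<pi>\<^sub>1 \<oplus>\<^sub>a \<pi>\<^sub>2) g)"
    proof (rule surjI)
      show "(\<pi>\<^sub>1 \<oplus>\<^sub>a \<pi>\<^sub>2) g ((\<pi>\<^sub>1 \<oplus>\<^sub>a \<pi>\<^sub>2) (- g) x) = x" for x
        by (cases x) (simp add: direct_sum_action_def unitary_rep_inverse[OF 1] unitary_rep_inverse[OF 2])
    qed
    show "cinner ((\<pi>\<^sub>1 \<oplus>\<^sub>a \<pi>\<^sub>2) g x) ((\<pi>\<^sub>1 \<oplus>\<^sub>a \<pi>\<^sub>2) g y) = cinner x y" for x y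
      by (cases x; cases y)
        (simp add: direct_sum_action_def cinner_prod_def unitary_rep_cinner[OF 1] unitary_rep_cinner[OF 2])
  qed
  moreover have "continuous_on UNIV (\<lambda>g. (\<pi>\<^sub>1 \<oplus>\<^sub>a \<pi>\<^sub>2) g v)" for v
    using 1 2 by (cases v) (simp add: direct_sum_action_def unitary_rep_def continuous_on_Pair)
  ultimately show ?thesis
    using 1 2 unfolding unitary_rep_def by (auto simp: direct_sum_action_def fun_eq_iff)
qed

subsection \<open>Invariant affine subspaces\<close>

lemma affine_isometric_actionE:
  assumes "affine_isometric_action \<alpha>"
  obtains \<pi> b where "unitary_rep \<pi>" "cocycle \<pi> b" "\<alpha> = (\<lambda>g v. \<pi> g v + b g)"
    "linear_part \<alpha> = \<pi>" "translation_part \<alpha> = b"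
  using assms unfolding affine_isometric_action_def
  by (metis linear_part_eq translation_part_eq)

lemma scaleC_convex_combination:
  fixes x y :: "'a::complex_inner"
  assumes "u + v = 1"
  shows "u *\<^sub>C x + v *\<^sub>C y = u *\<^sub>C (x - y) + y"
proof -
  have "(u + v) *\<^sub>C y = y" using assms by simp
  then show ?thesis
    by (simp add: scaleC_add_left complex_vector.scale_right_diff_distrib algebra_simps)
qed

text \<open>Scalar multiples are affine combinations with the base point \<open>s\<close>, and sums
  are doubled midpoints. In the difference of the images of \<open>w + s\<close> and
  \<open>s\<close> the translation parts cancel, which leaves \<open>\<pi> g w\<close>.\<close>

lemma direction_closed_invariant:
  fixes \<pi> :: "'g::topological_group_add \<Rightarrow> 'a::complex_hilbert \<Rightarrow> 'a"
  assumes \<pi>: "unitary_rep \<pi>" and S: "closed S" "caffine S" "s \<in> S"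
    and inv: "\<And>g x. x \<in> S \<Longrightarrow> \<pi> g x + b g \<in> S"
  shows "closed_invariant_subspace \<pi> ((\<lambda>x. x - s) ` S)"
proof -
  let ?V = "(\<lambda>x. x - s) ` S"
  have V: "w \<in> ?V \<longleftrightarrow> w + s \<in> S" for w
    by (auto simp: image_iff algebra_simps)
  have scale: "c *\<^sub>C w \<in> ?V" if "w \<in> ?V" for c w
  proof -
    have "c *\<^sub>C (w + s) + (1 - c) *\<^sub>C s \<in> S"
      using S(2,3) that unfolding V caffine_def by force
    then show ?thesis
      unfolding V by (subst (asm) scaleC_convex_combination) auto
  qed
  have add: "w + w' \<in> ?V" if "w \<in> ?V" "w' \<in> ?V" for w w'
  proof -
    have "(1/2) *\<^sub>C (w + s) + (1/2) *\<^sub>C (w' + s) \<in> S"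
      using S(2) that unfolding V caffine_def by force
    then have "(1/2) *\<^sub>C (w + s) + (1/2) *\<^sub>C (w' + s) - s \<in> ?V" by simp
    moreover have "(1/2) *\<^sub>C (w + s) + (1/2) *\<^sub>C (w' + s) - s = (1/2) *\<^sub>C (w + w')"
      by (subst scaleC_convex_combination) (simp_all add: scaleC_add_right complex_vector.scale_right_diff_distrib algebra_simps flip: scaleC_add_left)
    ultimately have "(1/2) *\<^sub>C (w + w') \<in> ?V" by simp
    from scale[OF this, of 2] show ?thesis by simp
  qed
  have sub: "csubspace ?V"
    unfolding complex_vector.subspace_def using S(3) scale add by (auto simp: V)
  have "\<pi> g w \<in> ?V" if "w \<in> ?V" for g w
  proof -
    have "\<pi> g (w + s) + b g - s \<in> ?V" "\<pi> g s + b g - s \<in> ?V"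
      using inv S(3) that by (simp_all add: V)
    from complex_vector.subspace_diff[OF sub this] show ?thesis
      by (simp add: unitary_rep_add[OF \<pi>])
  qed
  moreover have "closed ?V"
    using closed_translation_subtract[OF S(1), of s] by simp
  ultimately show ?thesis using sub by (auto simp: closed_invariant_subspace_def)
qed

text \<open>The assumption on \<open>s\<close> says that \<open>orth_proj K s\<close> is fixed by
  the projected action on \<open>K\<close>. The fibre of the projection over a fixed point is
  closed, affine and invariant, so irreducibility makes it the whole space, which forces
  \<open>K\<close> to be trivial.\<close>

lemma irreducible_action_orth_zero:
  fixes \<alpha> :: "'g::topological_group_add \<Rightarrow> 'a::complex_hilbert \<Rightarrow> 'a"
  assumes \<alpha>: "affine_isometric_action \<alpha>" "irreducible_action \<alpha>"
    and K: "closed_invariant_subspace (linear_part \<alpha>) K"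
    and s: "\<And>g k. k \<in> K \<Longrightarrow> cinner (\<alpha> g s - s) k = 0"
    and k: "k \<in> K"
  shows "k = 0"
proof -
  obtain \<pi> b where \<pi>: "unitary_rep \<pi>" and \<alpha>_eq: "\<alpha> = (\<lambda>g v. \<pi> g v + b g)" and lp: "linear_part \<alpha> = \<pi>"
    using \<alpha>(1) by (rule affine_isometric_actionE)
  note KI = K[unfolded lp]
  note KD = closed_invariant_subspaceD[OF KI]
  let ?P = "orth_proj K"
  define S where "S = {x. ?P x = ?P s}"
  have "S \<noteq> {}" unfolding S_def by blast
  moreover have "closed S" unfolding S_def
    by (intro closed_Collect_eq linear_continuous_on bounded_linear_orth_proj KD continuous_on_const)
  moreover have "caffine S" unfolding caffine_def S_def
    by (auto simp: orth_proj_add[OF KD(1,2)] orth_proj_scaleC[OF KD(1,2)] simp flip: scaleC_add_left)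
  moreover have "\<alpha> g ` S \<subseteq> S" for g
  proof
    fix y assume "y \<in> \<alpha> g ` S"
    then obtain x where x: "?P x = ?P s" "y = \<alpha> g x" by (auto simp: S_def)
    have "?P (\<alpha> g s - s) = 0"
      using s by (simp add: orth_proj_eq_0_iff[OF KD(1,2)])
    moreover have "?P (\<alpha> g x) = ?P (\<alpha> g s)"
      by (simp add: \<alpha>_eq orth_proj_add[OF KD(1,2)] orth_proj_unitary_rep[OF \<pi> KI] x)
    ultimately show "y \<in> S" by (simp add: S_def x(2) orth_proj_diff[OF KD(1,2)])
  qed
  ultimately have "S = UNIV" using \<alpha>(2) unfolding irreducible_action_def by blast
  then have "?P (s + k) = ?P s" by (auto simp: S_def)
  then show "k = 0" by (simp add: orth_proj_add[OF KD(1,2)] orth_proj_id[OF KD(1,2) k])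
qed

section \<open>Spectral cut-off of a closed graph\<close>

text \<open>\<open>R\<close> is the compression to \<open>W\<close> of the projection onto the first summand. Both coordinate maps are
  injective on \<open>W\<close>, so \<open>R - R\<^sup>2\<close> is injective there, and it is bounded below on the spectral subspace
  of \<open>(R - R\<^sup>2)\<^sup>2\<close> above any positive threshold.\<close>

lemma ex_subspace_coordinates_bounded_below:
  fixes W :: "('a::complex_hilbert \<times> 'b::complex_hilbert) set"
  assumes W: "csubspace W" "closed W" "W \<noteq> {0}"
    and fst0: "\<forall>k. (k, 0) \<in> W \<longrightarrow> k = 0" and snd0: "\<forall>k. (0, k) \<in> W \<longrightarrow> k = 0"
  obtains M \<delta> where "csubspace M" "closed M" "M \<noteq> {0}" "M \<subseteq> W" "\<delta> > 0"
    "\<And>w. w \<in> M \<Longrightarrow> \<delta> * norm w \<le> norm (fst w)"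
    "\<And>w. w \<in> M \<Longrightarrow> \<delta> * norm w \<le> norm (snd w)"
    "\<And>U w. bounded_linear U \<Longrightarrow> (\<And>x. U (orth_proj W x) = orth_proj W (U x)) \<Longrightarrow>
       (\<And>x. U (fst x, 0) = (fst (U x), 0)) \<Longrightarrow> w \<in> M \<Longrightarrow> U w \<in> M"
proof -
  let ?P = "orth_proj W"
  note P = bounded_linear_orth_proj[OF W(1,2)]
  note Pin = orth_proj_in[OF W(1,2)] and Pid = orth_proj_id[OF W(1,2)]
  define R where "R x = ?P (fst (?P x), 0)" for x
  define B where "B x = R x - R (R x)" for x
  have R: "bounded_linear R"
    unfolding R_def
    by (intro bounded_linear_compose[OF P] bounded_linear_Pair bounded_linear_zero
        bounded_linear_compose[OF bounded_linear_fst] P)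
  have B: "bounded_linear B"
    unfolding B_def by (intro bounded_linear_sub bounded_linear_compose[OF R] R)
  note linR = bounded_linear.linear[OF R] and linB = bounded_linear.linear[OF B]
  have symR: "inner (R x) y = inner x (R y)" for x y
  proof -
    have "inner (R x) y = inner (fst (?P x), 0) (?P y)"
      unfolding R_def by (rule inner_orth_proj_swap[OF W(1,2)])
    also have "\<dots> = inner (?P x) (fst (?P y), 0)"
      by (simp add: inner_prod_def)
    also have "\<dots> = inner x (R y)"
      unfolding R_def by (rule inner_orth_proj_swap[OF W(1,2)])
    finally show ?thesis .
  qed
  have symB: "inner (B x) y = inner x (B y)" for x y
    unfolding B_def by (simp add: inner_diff_left inner_diff_right symR)
  have Rin: "R x \<in> W" for x unfolding R_def by (rule Pin)
  have Rw: "R w = ?P (fst w, 0)" if "w \<in> W" for w by (simp add: R_def Pid that)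
  \<comment> \<open>1 - R is to the second coordinate what \<open>R\<close> is to the first, so the
    two coordinates can be treated symmetrically.\<close>
  have R'w: "w - R w = ?P (0, snd w)" if "w \<in> W" for w
  proof -
    have "w - (fst w, 0) = (0, snd w)" by (cases w) simp
    then show ?thesis
      using orth_proj_diff[OF W(1,2), of w "(fst w, 0)"] that by (simp add: Rw Pid)
  qed
  have injR: "w = 0" if "w \<in> W" "R w = 0" for w
  proof -
    have "inner (R w) w = inner (fst w) (fst w)"
      using that(1) by (simp only: Rw inner_orth_proj_left[OF W(1,2)]) (simp add: inner_prod_def)
    then have "fst w = 0" using that by simp
    then show ?thesis using snd0[rule_format, of "snd w"] that(1) by (cases w) (auto simp: zero_prod_def)
  qed
  have injR': "w = 0" if "w \<in> W" "R w = w" for w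
  proof -
    have "inner (w - R w) w = inner (snd w) (snd w)"
      using that(1) by (simp only: R'w inner_orth_proj_left[OF W(1,2)]) (simp add: inner_prod_def)
    then have "snd w = 0" using that by simp
    then show ?thesis using fst0[rule_format, of "fst w"] that(1) by (cases w) (auto simp: zero_prod_def)
  qed
  \<comment> \<open>\<open>B w = R (w - R w)\<close>, so injectivity of \<open>R\<close> and then of
    1 - R applies.\<close>
  have injB: "w = 0" if "w \<in> W" "B w = 0" for w
  proof (rule injR'[OF that(1)])
    have "R (w - R w) = 0" using that(2) by (simp add: B_def linear_diff[OF linR])
    then have "w - R w = 0"
      using injR complex_vector.subspace_diff[OF W(1) that(1) Rin] by blast
    then show "R w = w" by simp
  qed
  obtain x\<^sub>0 where x\<^sub>0: "x\<^sub>0 \<in> W" "x\<^sub>0 \<noteq> 0"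
    using W(3) complex_vector.subspace_0[OF W(1)] by blast
  then have "B x\<^sub>0 \<noteq> 0" using injB by blast
  \<comment> \<open>The threshold must lie strictly below
    \<open>norm (B x\<^sub>0) / norm x\<^sub>0\<close> for the form of \<open>C\<close> to be
    positive at \<open>x\<^sub>0\<close>; half that ratio will do. Nonnegativity of the form on
    \<open>M\<close> then says that \<open>B\<close> is bounded below by \<epsilon> there.\<close>
  define \<epsilon> where "\<epsilon> = norm (B x\<^sub>0) / (2 * norm x\<^sub>0)"
  have \<epsilon>: "\<epsilon> > 0" using x\<^sub>0(2) \<open>B x\<^sub>0 \<noteq> 0\<close> by (simp add: \<epsilon>_def)
  define C where "C x = B (B x) - \<epsilon>\<^sup>2 *\<^sub>R x" for x
  have C: "bounded_linear C"
    unfolding C_def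
    by (intro bounded_linear_sub bounded_linear_compose[OF B] B bounded_linear_scaleR_right)
  have symC: "inner (C x) y = inner x (C y)" for x y
    unfolding C_def by (simp add: inner_diff_left inner_diff_right symB)
  have Cform: "inner (C x) x = (norm (B x))\<^sup>2 - (\<epsilon> * norm x)\<^sup>2" for x
    unfolding C_def by (simp add: inner_diff_left symB power2_norm_eq_inner power_mult_distrib)
  have "\<epsilon> * norm x\<^sub>0 < norm (B x\<^sub>0)" using x\<^sub>0(2) \<open>B x\<^sub>0 \<noteq> 0\<close> by (simp add: \<epsilon>_def)
  then have Cpos: "inner (C x\<^sub>0) x\<^sub>0 > 0"
    unfolding Cform using \<epsilon> by (simp add: power_strict_mono)
  obtain M where
    M: "closed M" "subspace M" "M \<noteq> {0}" "\<And>w. w \<in> M \<Longrightarrow> inner (C w) w \<ge> 0"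
    and Minv: "\<And>T w. bounded_linear T \<Longrightarrow> (\<And>y. T (C y) = C (T y)) \<Longrightarrow> w \<in> M \<Longrightarrow> T w \<in> M"
    by (fact ex_positive_spectral_subspace[OF C symC Cpos])
  have Bge: "\<epsilon> * norm w \<le> norm (B w)" if "w \<in> M" for w
    using M(4)[OF that] unfolding Cform by - (rule power2_le_imp_le, simp_all)
  have commC: "U (C y) = C (U y)"
    if U: "bounded_linear U" "\<And>x. U (orth_proj W x) = orth_proj W (U x)"
      "\<And>x. U (fst x, 0) = (fst (U x), 0)" for U y
  proof -
    note linU = bounded_linear.linear[OF U(1)]
    have UR: "U (R x) = R (U x)" for x
      unfolding R_def U(2) using U(3)[of "?P x"] by (simp add: U(2))
    have "U (B x) = B (U x)" for x
      unfolding B_def by (simp add: linear_diff[OF linU] UR)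
    then show ?thesis
      unfolding C_def by (simp add: linear_diff[OF linU] linear_scale[OF linU])
  qed
  have inv: "U w \<in> M" if "bounded_linear U" "\<And>x. U (orth_proj W x) = orth_proj W (U x)"
      "\<And>x. U (fst x, 0) = (fst (U x), 0)" "w \<in> M" for U w
    using Minv[OF that(1) commC[OF that(1-3)] that(4)] .
  have PR: "?P (R x) = R x" "R (?P x) = R x" for x
    by (simp_all add: Pid Rin) (simp add: R_def Pid Pin)
  have MW: "M \<subseteq> W"
  proof
    fix w assume w: "w \<in> M"
    \<comment> \<open>\<open>M\<close> is stable under \<open>?P\<close>, so it contains
      \<open>w - ?P w\<close>, the component orthogonal to \<open>W\<close>. There \<open>B\<close>
      vanishes, which the lower bound on \<open>M\<close> permits only for the zero vector.\<close>
    have "?P (C y) = C (?P y)" for y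
      using P[THEN bounded_linear.linear] unfolding C_def B_def
      by (simp add: linear_diff linear_scale PR)
    then have "?P w \<in> M" using Minv[OF P] w by blast
    then have "w - ?P w \<in> M" using M(2) w by (simp add: subspace_diff)
    moreover have "B (w - ?P w) = 0"
      unfolding B_def by (simp add: linear_diff[OF linR] linear_0[OF linR] PR)
    ultimately have "\<epsilon> * norm (w - ?P w) \<le> 0" using Bge by fastforce
    then have "w = ?P w" using \<epsilon> by (simp add: mult_le_0_iff)
    then show "w \<in> W" using Pin by metis
  qed
  have Rcontr: "norm (R x) \<le> norm x" for x
  proof -
    have "norm (R x) \<le> norm (fst (?P x), 0::'b)"
      unfolding R_def by (rule norm_orth_proj_le[OF W(1,2)])
    also have "\<dots> \<le> norm (?P x)" using norm_fst_le[of "fst (?P x)" "snd (?P x)"] by (simp add: norm_Pair)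
    also have "\<dots> \<le> norm x" by (rule norm_orth_proj_le[OF W(1,2)])
    finally show ?thesis .
  qed
  show ?thesis
  proof
    show "csubspace M"
      unfolding complex_vector.subspace_def
    proof (intro conjI ballI allI)
      show "0 \<in> M" by (rule subspace_0[OF M(2)])
      show "x + y \<in> M" if "x \<in> M" "y \<in> M" for x y using subspace_add[OF M(2) that] .
      \<comment> \<open>Multiplication by \<open>c\<close> is itself one of the operators
        \<open>U\<close> that preserve \<open>M\<close>.\<close>
      show "c *\<^sub>C x \<in> M" if "x \<in> M" for c x
      proof (rule inv[OF _ _ _ that])
        show "bounded_linear ((*\<^sub>C) c :: 'a \<times> 'b \<Rightarrow> _)"
        proof (rule bounded_linear_intro[where K="cmod c"])
          show "norm (c *\<^sub>C x) \<le> norm x * cmod c" for x :: "'a \<times> 'b"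
          proof -
            have "complex_of_real ((norm (c *\<^sub>C x))\<^sup>2) = (c * cnj c) * complex_of_real ((norm x)\<^sup>2)"
              by (simp only: cinner_self[symmetric] cinner_scaleC_left cinner_scaleC_right mult_ac)
            also have "\<dots> = complex_of_real ((norm x * cmod c)\<^sup>2)"
              by (simp add: complex_norm_square[symmetric] power_mult_distrib)
            finally have "(norm (c *\<^sub>C x))\<^sup>2 = (norm x * cmod c)\<^sup>2" by (simp only: of_real_eq_iff)
            then show ?thesis by - (rule power2_le_imp_le, simp_all)
          qed
        qed (simp_all add: scaleC_add_right scaleC_scaleC mult.commute flip: scaleC_of_real)
        show "c *\<^sub>C orth_proj W x = orth_proj W (c *\<^sub>C x)" for x
          by (simp add: orth_proj_scaleC[OF W(1,2)])
        show "c *\<^sub>C (fst x, 0) = (fst (c *\<^sub>C x), 0)" for x :: "'a \<times> 'b"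
          by (simp add: scaleC_prod_def)
      qed
    qed
    show "closed M" "M \<noteq> {0}" "M \<subseteq> W" by fact+
    \<comment> \<open>The factor 2 comes from the triangle inequality in the bound of
      \<open>norm (B w)\<close> by \<open>2 * norm (R w)\<close>. The second coordinate, estimated
      through \<open>B w = R (w - R w)\<close>, would allow \<epsilon> itself.\<close>
    show "\<epsilon> / 2 > 0" using \<epsilon> by simp
    fix w assume w: "w \<in> M"
    then have wW: "w \<in> W" using MW by blast
    have "norm (B w) \<le> norm (R w) + norm (R (R w))" unfolding B_def by (rule norm_triangle_ineq4)
    also have "\<dots> \<le> 2 * norm (R w)" using Rcontr[of "R w"] by simp
    also have "\<dots> \<le> 2 * norm (fst w)"
      using norm_orth_proj_le[OF W(1,2), of "(fst w, 0)"] by (simp add: Rw wW norm_Pair)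
    finally show "\<epsilon> / 2 * norm w \<le> norm (fst w)" using Bge[OF w] by simp
    have "norm (B w) = norm (R (w - R w))" by (simp add: B_def linear_diff[OF linR])
    also have "\<dots> \<le> norm (w - R w)" by (rule Rcontr)
    also have "\<dots> \<le> norm (snd w)"
      using norm_orth_proj_le[OF W(1,2), of "(0, snd w)"] by (simp add: R'w wW norm_Pair)
    finally show "\<epsilon> / 2 * norm w \<le> norm (snd w)"
      using Bge[OF w] norm_ge_zero[of "snd w"] by (simp only: times_divide_eq_left)
  qed (fact inv)
qed

section \<open>Reducibility from equivalent projected actions\<close>

lemma reducible_if_equivalent_projected_actions:
  fixes \<alpha>\<^sub>1 :: "'g::topological_group_add \<Rightarrow> 'a::complex_hilbert \<Rightarrow> 'a"
    and \<alpha>\<^sub>2 :: "'g \<Rightarrow> 'b::complex_hilbert \<Rightarrow> 'b"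
  assumes \<alpha>: "affine_isometric_action \<alpha>\<^sub>1" "affine_isometric_action \<alpha>\<^sub>2"
    and K\<^sub>1: "closed_invariant_subspace (linear_part \<alpha>\<^sub>1) K\<^sub>1"
    and K\<^sub>2: "closed_invariant_subspace (linear_part \<alpha>\<^sub>2) K\<^sub>2" "K\<^sub>2 \<noteq> {0}"
    and eq: "equivalent_actions K\<^sub>1 (projected_action \<alpha>\<^sub>1 K\<^sub>1) K\<^sub>2 (projected_action \<alpha>\<^sub>2 K\<^sub>2)"
  shows "\<not> irreducible_action (\<alpha>\<^sub>1 \<oplus>\<^sub>a \<alpha>\<^sub>2)"
proof -
  obtain A where A: "bij_betw A K\<^sub>1 K\<^sub>2" "continuous_on K\<^sub>1 A" "caffine_map_on K\<^sub>1 A"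
    and equiv: "\<And>g v. v \<in> K\<^sub>1 \<Longrightarrow> A (projected_action \<alpha>\<^sub>1 K\<^sub>1 g v) = projected_action \<alpha>\<^sub>2 K\<^sub>2 g (A v)"
    using eq unfolding equivalent_actions_def by blast
  note D\<^sub>1 = closed_invariant_subspaceD(1,2)[OF K\<^sub>1] and D\<^sub>2 = closed_invariant_subspaceD(1,2)[OF K\<^sub>2(1)]
  \<comment> \<open>The projection intertwines an action with its projected action; together with
    equivariance of \<open>A\<close> this makes \<open>S\<close> invariant.\<close>
  have proj: "orth_proj K (\<alpha> g v) = projected_action \<alpha> K g (orth_proj K v)"
    if \<alpha>: "affine_isometric_action \<alpha>" and K: "closed_invariant_subspace (linear_part \<alpha>) K"
    for \<alpha> :: "'g \<Rightarrow> 'c::complex_hilbert \<Rightarrow> 'c" and K g v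
  proof -
    obtain \<pi> b where \<pi>: "unitary_rep \<pi>" and eqs: "\<alpha> = (\<lambda>g v. \<pi> g v + b g)" "linear_part \<alpha> = \<pi>" "translation_part \<alpha> = b"
      using \<alpha> by (rule affine_isometric_actionE)
    note K = K[unfolded eqs(2)]
    show ?thesis
      unfolding projected_action_def eqs(2,3)
      by (simp add: eqs(1) orth_proj_add[OF closed_invariant_subspaceD(1,2)[OF K]] orth_proj_unitary_rep[OF \<pi> K])
  qed
  define S where "S = {x. A (orth_proj K\<^sub>1 (fst x)) = orth_proj K\<^sub>2 (snd x)}"
  have "closed S"
    unfolding S_def
  proof (rule closed_Collect_eq)
    show "continuous_on UNIV (\<lambda>x :: 'a \<times> 'b. A (orth_proj K\<^sub>1 (fst x)))"
    proof (rule continuous_on_compose2[OF A(2)])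
      show "continuous_on UNIV (\<lambda>x :: 'a \<times> 'b. orth_proj K\<^sub>1 (fst x))"
        by (rule linear_continuous_on[OF bounded_linear_compose[OF bounded_linear_orth_proj[OF D\<^sub>1] bounded_linear_fst]])
    qed (use orth_proj_in[OF D\<^sub>1] in auto)
    show "continuous_on UNIV (\<lambda>x :: 'a \<times> 'b. orth_proj K\<^sub>2 (snd x))"
      by (rule linear_continuous_on[OF bounded_linear_compose[OF bounded_linear_orth_proj[OF D\<^sub>2] bounded_linear_snd]])
  qed
  moreover have "S \<noteq> {}"
  proof -
    have "A 0 \<in> K\<^sub>2" using A(1) complex_vector.subspace_0[OF D\<^sub>1(1)] by (auto simp: bij_betw_def)
    then have "(0, A 0) \<in> S"
      by (simp add: S_def orth_proj_id[OF D\<^sub>1] orth_proj_id[OF D\<^sub>2] complex_vector.subspace_0[OF D\<^sub>1(1)])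
    then show ?thesis by blast
  qed
  moreover have "S \<noteq> UNIV"
  proof
    assume "S = UNIV"
    obtain k where k: "k \<in> K\<^sub>2" "k \<noteq> 0"
      using K\<^sub>2(2) complex_vector.subspace_0[OF D\<^sub>2(1)] by blast
    \<comment> \<open>The two points share the first coordinate, so membership in \<open>S\<close>
      would give their second coordinates the same projection to \<open>K\<^sub>2\<close>.\<close>
    have "(0, 0) \<in> S" "(0, k) \<in> S" using \<open>S = UNIV\<close> by auto
    then show False
      using k by (simp add: S_def orth_proj_id[OF D\<^sub>2] complex_vector.subspace_0[OF D\<^sub>2(1)])
  qed
  moreover have "caffine S"
    unfolding caffine_def
  proof (intro ballI allI impI)
    fix x y and u v :: complex assume "x \<in> S" "y \<in> S" "u + v = 1"
    then show "u *\<^sub>C x + v *\<^sub>C y \<in> S"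
      using A(3) orth_proj_in[OF D\<^sub>1] unfolding caffine_map_on_def
      by (simp add: S_def scaleC_prod_def orth_proj_add[OF D\<^sub>1] orth_proj_scaleC[OF D\<^sub>1]
          orth_proj_add[OF D\<^sub>2] orth_proj_scaleC[OF D\<^sub>2])
  qed
  moreover have "(\<alpha>\<^sub>1 \<oplus>\<^sub>a \<alpha>\<^sub>2) g ` S \<subseteq> S" for g
  proof
    fix y assume "y \<in> (\<alpha>\<^sub>1 \<oplus>\<^sub>a \<alpha>\<^sub>2) g ` S"
    then obtain x where x: "x \<in> S" "y = (\<alpha>\<^sub>1 g (fst x), \<alpha>\<^sub>2 g (snd x))"
      by (auto simp: direct_sum_action_def)
    then show "y \<in> S"
      by (simp add: S_def proj[OF \<alpha>(1) K\<^sub>1] proj[OF \<alpha>(2) K\<^sub>2(1)] equiv orth_proj_in[OF D\<^sub>1])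
  qed
  ultimately show ?thesis unfolding irreducible_action_def by blast
qed

section \<open>Equivalent projected actions from reducibility\<close>

text \<open>With \<open>J\<^sub>i\<close> the adjoint of the \<open>i\<close>-th coordinate map of \<open>M\<close>, the equivalence \<open>A\<close> solves
  \<open>J\<^sub>1 v + J\<^sub>2 (A v) = m\<close>, where \<open>m\<close> is a fixed point of the projected action of the direct sum on \<open>M\<close>.\<close>

lemma equivalent_projected_actions_of_graph:
  fixes \<alpha>\<^sub>1 :: "'g::topological_group_add \<Rightarrow> 'a::complex_hilbert \<Rightarrow> 'a"
    and \<alpha>\<^sub>2 :: "'g \<Rightarrow> 'b::complex_hilbert \<Rightarrow> 'b"
  assumes \<alpha>\<^sub>1: "unitary_rep \<pi>\<^sub>1" "\<alpha>\<^sub>1 = (\<lambda>g v. \<pi>\<^sub>1 g v + b\<^sub>1 g)"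
    and \<alpha>\<^sub>2: "unitary_rep \<pi>\<^sub>2" "\<alpha>\<^sub>2 = (\<lambda>g v. \<pi>\<^sub>2 g v + b\<^sub>2 g)"
    and M: "closed_invariant_subspace (\<pi>\<^sub>1 \<oplus>\<^sub>a \<pi>\<^sub>2) M"
    and fixed: "\<And>g. orth_proj M ((\<alpha>\<^sub>1 \<oplus>\<^sub>a \<alpha>\<^sub>2) g s) = orth_proj M s"
    and \<delta>: "\<delta> > 0" "\<And>w. w \<in> M \<Longrightarrow> \<delta> * norm w \<le> norm (fst w)"
      "\<And>w. w \<in> M \<Longrightarrow> \<delta> * norm w \<le> norm (snd w)"
  shows "closed_invariant_subspace \<pi>\<^sub>1 (fst ` M)" "closed_invariant_subspace \<pi>\<^sub>2 (snd ` M)"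
    "equivalent_actions (fst ` M) (projected_action \<alpha>\<^sub>1 (fst ` M)) (snd ` M) (projected_action \<alpha>\<^sub>2 (snd ` M))"
proof -
  let ?P = "orth_proj M" and ?\<pi> = "\<pi>\<^sub>1 \<oplus>\<^sub>a \<pi>\<^sub>2"
  let ?K\<^sub>1 = "fst ` M" and ?K\<^sub>2 = "snd ` M"
  note MD = closed_invariant_subspaceD[OF M]
  note \<pi> = unitary_rep_direct_sum[OF \<alpha>\<^sub>1(1) \<alpha>\<^sub>2(1)]
  note Padd = orth_proj_add[OF MD(1,2)] and Pscale = orth_proj_scaleC[OF MD(1,2)]
    and Pdiff = orth_proj_diff[OF MD(1,2)] and Pin = orth_proj_in[OF MD(1,2)]
    and Pcomm = orth_proj_unitary_rep[OF \<pi> M]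
  define J\<^sub>1 where "J\<^sub>1 = (\<lambda>v. ?P (v, 0))"
  define J\<^sub>2 where "J\<^sub>2 = (\<lambda>v. ?P (0, v))"
  have \<iota>\<^sub>1: "bounded_linear (\<lambda>v::'a. (v, 0::'b))" and \<iota>\<^sub>2: "bounded_linear (\<lambda>v::'b. (0::'a, v))"
    by (intro bounded_linear_Pair bounded_linear_ident bounded_linear_zero)+
  have sc: "fst (c *\<^sub>C x) = c *\<^sub>C fst x" "snd (c *\<^sub>C x) = c *\<^sub>C snd x"
      "(c *\<^sub>C y, 0) = c *\<^sub>C (y, 0)" "(0, c *\<^sub>C z) = c *\<^sub>C (0, z)"
      "inner (y, 0) x = inner y (fst x)" "inner (0, z) x = inner z (snd x)"
    for c and x :: "'a \<times> 'b" and y :: 'a and z :: 'b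
    by (simp_all add: scaleC_prod_def inner_prod_def)
  have K\<^sub>1: "closed ?K\<^sub>1" "csubspace ?K\<^sub>1" and bij\<^sub>1: "bij_betw J\<^sub>1 ?K\<^sub>1 M"
    unfolding J\<^sub>1_def
    by (rule bij_betw_restricted_adjoint[where f = fst and \<iota> = "\<lambda>v. (v, 0)",
          OF MD(1,2) bounded_linear_fst sc(1) \<iota>\<^sub>1 sc(3,5) \<delta>(1,2)]; assumption)+
  have K\<^sub>2: "closed ?K\<^sub>2" "csubspace ?K\<^sub>2" and bij\<^sub>2: "bij_betw J\<^sub>2 ?K\<^sub>2 M"
    and lower: "\<And>v. v \<in> ?K\<^sub>2 \<Longrightarrow> \<delta> * norm v \<le> norm (J\<^sub>2 v)"
    unfolding J\<^sub>2_def
    by (rule bij_betw_restricted_adjoint[where f = snd and \<iota> = "\<lambda>v. (0, v)",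
          OF MD(1,2) bounded_linear_snd sc(2) \<iota>\<^sub>2 sc(4,6) \<delta>(1,3)]; assumption)+
  have inv\<^sub>1: "\<pi>\<^sub>1 g v \<in> ?K\<^sub>1" if "v \<in> ?K\<^sub>1" for g v
    using that MD(3)[of _ g] by (force simp: direct_sum_action_def image_iff)
  have inv\<^sub>2: "\<pi>\<^sub>2 g v \<in> ?K\<^sub>2" if "v \<in> ?K\<^sub>2" for g v
    using that MD(3)[of _ g] by (force simp: direct_sum_action_def image_iff)
  show I\<^sub>1: "closed_invariant_subspace \<pi>\<^sub>1 ?K\<^sub>1" and I\<^sub>2: "closed_invariant_subspace \<pi>\<^sub>2 ?K\<^sub>2"
    using K\<^sub>1 K\<^sub>2 inv\<^sub>1 inv\<^sub>2 unfolding closed_invariant_subspace_def by blast+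
  \<comment> \<open>\<open>J\<^sub>1\<close> takes values in \<open>M\<close> everywhere and
    \<open>J\<^sub>2\<close> maps \<open>?K\<^sub>2\<close> onto \<open>M\<close>, so the defining
    relation of \<open>A\<close> holds for all \<open>v\<close>; only bijectivity is confined to
    \<open>?K\<^sub>1\<close>.\<close>
  define A where "A v = inv_into ?K\<^sub>2 J\<^sub>2 (?P s - J\<^sub>1 v)" for v
  have tgt: "?P s - J\<^sub>1 v \<in> M" for v
    unfolding J\<^sub>1_def by (intro complex_vector.subspace_diff MD Pin)
  have AK: "A v \<in> ?K\<^sub>2" for v
    unfolding A_def using tgt bij\<^sub>2 by (metis bij_betw_def inv_into_into)
  have JA: "J\<^sub>2 (A v) = ?P s - J\<^sub>1 v" for v
    unfolding A_def using tgt bij\<^sub>2 by (metis bij_betw_def f_inv_into_f)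
  \<comment> \<open>\<open>A v\<close> is the only \<open>w\<close> in \<open>?K\<^sub>2\<close>
    with \<open>?P (v, w) = ?P s\<close>. Affinity and equivariance of \<open>A\<close> are both
    read off from this relation.\<close>
  have A_eqI: "A v = w" if "w \<in> ?K\<^sub>2" "?P (v, w) = ?P s" for v w
  proof -
    have "J\<^sub>1 v + J\<^sub>2 w = ?P s"
      using that(2) by (simp add: J\<^sub>1_def J\<^sub>2_def flip: Padd)
    then have "J\<^sub>2 (A v) = J\<^sub>2 w" by (simp add: JA algebra_simps)
    then show ?thesis using AK that(1) bij\<^sub>2 by (metis bij_betw_def inj_onD)
  qed
  have PA: "?P (v, A v) = ?P s" for v
  proof -
    have "?P (v, A v) = J\<^sub>1 v + J\<^sub>2 (A v)" by (simp add: J\<^sub>1_def J\<^sub>2_def flip: Padd)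
    then show ?thesis by (simp add: JA)
  qed
  have "bij_betw (inv_into ?K\<^sub>2 J\<^sub>2 \<circ> ((\<lambda>m. ?P s - m) \<circ> J\<^sub>1)) ?K\<^sub>1 ?K\<^sub>2"
  proof (intro bij_betw_trans[OF bij\<^sub>1 ] bij_betw_trans[OF _ bij_betw_inv_into[OF bij\<^sub>2]])
    show "bij_betw (\<lambda>m. ?P s - m) M M"
      by (rule bij_betw_byWitness[where f' = "\<lambda>m. ?P s - m"])
        (auto intro!: complex_vector.subspace_diff MD Pin)
  qed
  then have bijA: "bij_betw A ?K\<^sub>1 ?K\<^sub>2" by (simp add: o_def A_def[abs_def])
  \<comment> \<open>\<delta> bounds \<open>J\<^sub>2\<close> from below, while
    \<open>J\<^sub>1\<close> does not increase norms.\<close>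
  have "dist (A v) (A w) \<le> 1 / \<delta> * dist v w" for v w
  proof -
    have "A v - A w \<in> ?K\<^sub>2" by (intro complex_vector.subspace_diff K\<^sub>2 AK)
    then have "\<delta> * norm (A v - A w) \<le> norm (J\<^sub>2 (A v - A w))" by (rule lower)
    also have "J\<^sub>2 (A v - A w) = J\<^sub>2 (A v) - J\<^sub>2 (A w)" by (simp add: J\<^sub>2_def flip: Pdiff)
    also have "\<dots> = ?P (w - v, 0)" by (simp add: JA J\<^sub>1_def flip: Pdiff)
    also have "norm \<dots> \<le> norm (v - w)"
      using norm_orth_proj_le[OF MD(1,2), of "(w - v, 0)"] by (simp add: norm_Pair norm_minus_commute)
    finally show ?thesis using \<delta>(1) by (simp add: dist_norm field_simps)
  qed
  then have "continuous_on ?K\<^sub>1 A"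
    using \<delta>(1) by (intro lipschitz_on_continuous_on[of "1/\<delta>"]) (auto simp: lipschitz_on_def)
  moreover have "caffine_map_on ?K\<^sub>1 A"
    unfolding caffine_map_on_def
  proof (intro ballI allI impI)
    fix x y and u v :: complex assume uv: "u + v = 1"
    show "A (u *\<^sub>C x + v *\<^sub>C y) = u *\<^sub>C A x + v *\<^sub>C A y"
    proof (rule A_eqI)
      show "u *\<^sub>C A x + v *\<^sub>C A y \<in> ?K\<^sub>2"
        by (intro complex_vector.subspace_add complex_vector.subspace_scale K\<^sub>2 AK)
      have "?P (u *\<^sub>C (x, A x) + v *\<^sub>C (y, A y)) = (u + v) *\<^sub>C ?P s"
        by (simp only: Padd Pscale PA scaleC_add_left)
      then show "?P (u *\<^sub>C x + v *\<^sub>C y, u *\<^sub>C A x + v *\<^sub>C A y) = ?P s"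
        using uv by (simp add: scaleC_prod_def)
    qed
  qed
  moreover have "A (projected_action \<alpha>\<^sub>1 ?K\<^sub>1 g v) = projected_action \<alpha>\<^sub>2 ?K\<^sub>2 g (A v)" for g v
  proof (rule A_eqI)
    have lp: "linear_part \<alpha>\<^sub>1 = \<pi>\<^sub>1" "translation_part \<alpha>\<^sub>1 = b\<^sub>1" "linear_part \<alpha>\<^sub>2 = \<pi>\<^sub>2" "translation_part \<alpha>\<^sub>2 = b\<^sub>2"
      using \<alpha>\<^sub>1 \<alpha>\<^sub>2 by (simp_all add: linear_part_eq translation_part_eq)
    show "projected_action \<alpha>\<^sub>2 ?K\<^sub>2 g (A v) \<in> ?K\<^sub>2"
      unfolding projected_action_def lp
      by (intro complex_vector.subspace_add K\<^sub>2 inv\<^sub>2 AK orth_proj_in)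
    \<comment> \<open>\<open>M\<close> lies in the product of \<open>?K\<^sub>1\<close> and
      \<open>?K\<^sub>2\<close>, so \<open>?P\<close> does not see the parts of the cocycles
      orthogonal to these spaces, and the projected cocycles may replace the full ones.\<close>
    have "?P (b\<^sub>1 g - orth_proj ?K\<^sub>1 (b\<^sub>1 g), b\<^sub>2 g - orth_proj ?K\<^sub>2 (b\<^sub>2 g)) = 0"
      unfolding orth_proj_eq_0_iff[OF MD(1,2)] cinner_prod_def
      by (simp add: orth_proj_orth[OF K\<^sub>1(2,1)] orth_proj_orth[OF K\<^sub>2(2,1)])
    then have b: "?P (orth_proj ?K\<^sub>1 (b\<^sub>1 g), orth_proj ?K\<^sub>2 (b\<^sub>2 g)) = ?P (b\<^sub>1 g, b\<^sub>2 g)"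
      using Pdiff[of "(b\<^sub>1 g, b\<^sub>2 g)" "(orth_proj ?K\<^sub>1 (b\<^sub>1 g), orth_proj ?K\<^sub>2 (b\<^sub>2 g))"] by simp
    have "?P (projected_action \<alpha>\<^sub>1 ?K\<^sub>1 g v, projected_action \<alpha>\<^sub>2 ?K\<^sub>2 g (A v))
        = ?P (?\<pi> g (v, A v) + (orth_proj ?K\<^sub>1 (b\<^sub>1 g), orth_proj ?K\<^sub>2 (b\<^sub>2 g)))"
      by (simp add: projected_action_def lp direct_sum_action_def)
    also have "\<dots> = ?P (?\<pi> g s) + ?P (b\<^sub>1 g, b\<^sub>2 g)"
      by (simp only: Padd Pcomm PA b)
    also have "\<dots> = ?P ((\<alpha>\<^sub>1 \<oplus>\<^sub>a \<alpha>\<^sub>2) g s)"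
      by (cases s) (simp add: \<alpha>\<^sub>1(2) \<alpha>\<^sub>2(2) direct_sum_action_def flip: Padd)
    finally show "?P (projected_action \<alpha>\<^sub>1 ?K\<^sub>1 g v, projected_action \<alpha>\<^sub>2 ?K\<^sub>2 g (A v)) = ?P s"
      using fixed by simp
  qed
  ultimately show "equivalent_actions ?K\<^sub>1 (projected_action \<alpha>\<^sub>1 ?K\<^sub>1) ?K\<^sub>2 (projected_action \<alpha>\<^sub>2 ?K\<^sub>2)"
    using bijA unfolding equivalent_actions_def by blast
qed

lemma equivalent_projected_actions_if_reducible:
  fixes \<alpha>\<^sub>1 :: "'g::topological_group_add \<Rightarrow> 'a::complex_hilbert \<Rightarrow> 'a"
    and \<alpha>\<^sub>2 :: "'g \<Rightarrow> 'b::complex_hilbert \<Rightarrow> 'b"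
  assumes \<alpha>: "affine_isometric_action \<alpha>\<^sub>1" "irreducible_action \<alpha>\<^sub>1"
      "affine_isometric_action \<alpha>\<^sub>2" "irreducible_action \<alpha>\<^sub>2"
    and red: "\<not> irreducible_action (\<alpha>\<^sub>1 \<oplus>\<^sub>a \<alpha>\<^sub>2)"
  obtains K\<^sub>1 K\<^sub>2 where "closed_invariant_subspace (linear_part \<alpha>\<^sub>1) K\<^sub>1" "K\<^sub>1 \<noteq> {0}"
    "closed_invariant_subspace (linear_part \<alpha>\<^sub>2) K\<^sub>2" "K\<^sub>2 \<noteq> {0}"
    "equivalent_actions K\<^sub>1 (projected_action \<alpha>\<^sub>1 K\<^sub>1) K\<^sub>2 (projected_action \<alpha>\<^sub>2 K\<^sub>2)"
proof -
  obtain \<pi>\<^sub>1 b\<^sub>1 where \<pi>\<^sub>1: "unitary_rep \<pi>\<^sub>1" "\<alpha>\<^sub>1 = (\<lambda>g v. \<pi>\<^sub>1 g v + b\<^sub>1 g)" and lp\<^sub>1: "linear_part \<alpha>\<^sub>1 = \<pi>\<^sub>1"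
    using \<alpha>(1) by (rule affine_isometric_actionE)
  obtain \<pi>\<^sub>2 b\<^sub>2 where \<pi>\<^sub>2: "unitary_rep \<pi>\<^sub>2" "\<alpha>\<^sub>2 = (\<lambda>g v. \<pi>\<^sub>2 g v + b\<^sub>2 g)" and lp\<^sub>2: "linear_part \<alpha>\<^sub>2 = \<pi>\<^sub>2"
    using \<alpha>(3) by (rule affine_isometric_actionE)
  let ?\<alpha> = "\<alpha>\<^sub>1 \<oplus>\<^sub>a \<alpha>\<^sub>2" and ?\<pi> = "\<pi>\<^sub>1 \<oplus>\<^sub>a \<pi>\<^sub>2"
  note \<pi> = unitary_rep_direct_sum[OF \<pi>\<^sub>1(1) \<pi>\<^sub>2(1)]
  have sum_eq: "?\<alpha> g x = ?\<pi> g x + (b\<^sub>1 g, b\<^sub>2 g)" for g x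
    by (cases x) (simp add: direct_sum_action_def \<pi>\<^sub>1(2) \<pi>\<^sub>2(2))
  obtain S s where S: "closed S" "caffine S" "S \<noteq> UNIV" "s \<in> S" and Sinv: "\<And>g x. x \<in> S \<Longrightarrow> ?\<alpha> g x \<in> S"
    using red unfolding irreducible_action_def by blast
  define V where "V = (\<lambda>x. x - s) ` S"
  have V: "closed_invariant_subspace ?\<pi> V"
    unfolding V_def
    by (rule direction_closed_invariant[OF \<pi> S(1,2,4), of "\<lambda>g. (b\<^sub>1 g, b\<^sub>2 g)"]) (use Sinv in \<open>simp add: sum_eq\<close>)
  note VD = closed_invariant_subspaceD(1,2)[OF V]
  define W where "W = {w. orth_proj V w = 0}"
  have W: "closed_invariant_subspace ?\<pi> W"
    unfolding W_def by (rule closed_invariant_subspace_orth_complement[OF \<pi> V])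
  note WD = closed_invariant_subspaceD[OF W]
  \<comment> \<open>\<open>s\<close> and its image differ by a vector of \<open>V\<close>, so both
    have the same projection to \<open>W\<close>: this is the fixed point.\<close>
  have orthW: "cinner (?\<alpha> g s - s) w = 0" if "w \<in> W" for g w
  proof -
    have "?\<alpha> g s - s \<in> V" using Sinv S(4) by (simp add: V_def)
    then have "cinner w (?\<alpha> g s - s) = 0"
      using that orth_proj_eq_0_iff[OF VD] by (simp add: W_def)
    then show ?thesis by (metis cinner_commute complex_cnj_zero)
  qed
  have W0: "W \<noteq> {0}"
  proof
    assume "W = {0}"
    have "x \<in> S" for x
    proof -
      have "x - s - orth_proj V (x - s) \<in> W"
        by (simp add: W_def orth_proj_diff[OF VD] orth_proj_id[OF VD] orth_proj_in[OF VD])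
      then have "x - s \<in> V" using \<open>W = {0}\<close> orth_proj_in[OF VD, of "x - s"] by simp
      then show ?thesis by (auto simp: V_def)
    qed
    then show False using S(3) by blast
  qed
  \<comment> \<open>The slice of \<open>W\<close> along the first summand is a closed invariant
    subspace, and \<open>orthW\<close> on it says that the projection of \<open>fst s\<close> is
    fixed by the projected action of \<open>\<alpha>\<^sub>1\<close>.\<close>
  have fst0: "\<forall>k. (k, 0) \<in> W \<longrightarrow> k = 0"
  proof (intro allI impI, rule irreducible_action_orth_zero[OF \<alpha>(1,2)])
    show "k \<in> {k. (k, 0) \<in> W}" if "(k, 0) \<in> W" for k using that by simp
    show "closed_invariant_subspace (linear_part \<alpha>\<^sub>1) {k. (k, 0) \<in> W}"
      unfolding lp\<^sub>1 closed_invariant_subspace_def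
    proof (intro conjI allI)
      show "csubspace {k. (k, 0) \<in> W}"
        using complex_vector.subspace_0[OF WD(1)] complex_vector.subspace_add[OF WD(1)]
          complex_vector.subspace_scale[OF WD(1)]
        unfolding complex_vector.subspace_def by (force simp: zero_prod_def scaleC_prod_def)
      have "continuous_on UNIV (\<lambda>k::'a. (k, 0::'b))" by (intro continuous_intros)
      from closed_vimage[OF WD(2) this] show "closed {k. (k, 0) \<in> W}" by (simp add: vimage_def)
      show "\<pi>\<^sub>1 g ` {k. (k, 0) \<in> W} \<subseteq> {k. (k, 0) \<in> W}" for g
        using WD(3)[of _ g] by (force simp: direct_sum_action_def unitary_rep_zero[OF \<pi>\<^sub>2(1)])
    qed
    show "cinner (\<alpha>\<^sub>1 g (fst s) - fst s) k = 0" if "k \<in> {k. (k, 0) \<in> W}" for g k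
      using orthW[of "(k, 0)" g] that by (cases s) (simp add: direct_sum_action_def cinner_prod_def)
  qed
  have snd0: "\<forall>k. (0, k) \<in> W \<longrightarrow> k = 0"
  proof (intro allI impI, rule irreducible_action_orth_zero[OF \<alpha>(3,4)])
    show "k \<in> {k. (0, k) \<in> W}" if "(0, k) \<in> W" for k using that by simp
    show "closed_invariant_subspace (linear_part \<alpha>\<^sub>2) {k. (0, k) \<in> W}"
      unfolding lp\<^sub>2 closed_invariant_subspace_def
    proof (intro conjI allI)
      show "csubspace {k. (0, k) \<in> W}"
        using complex_vector.subspace_0[OF WD(1)] complex_vector.subspace_add[OF WD(1)]
          complex_vector.subspace_scale[OF WD(1)]
        unfolding complex_vector.subspace_def by (force simp: zero_prod_def scaleC_prod_def)
      have "continuous_on UNIV (\<lambda>k::'b. (0::'a, k))" by (intro continuous_intros)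
      from closed_vimage[OF WD(2) this] show "closed {k. (0, k) \<in> W}" by (simp add: vimage_def)
      show "\<pi>\<^sub>2 g ` {k. (0, k) \<in> W} \<subseteq> {k. (0, k) \<in> W}" for g
        using WD(3)[of _ g] by (force simp: direct_sum_action_def unitary_rep_zero[OF \<pi>\<^sub>1(1)])
    qed
    show "cinner (\<alpha>\<^sub>2 g (snd s) - snd s) k = 0" if "k \<in> {k. (0, k) \<in> W}" for g k
      using orthW[of "(0, k)" g] that by (cases s) (simp add: direct_sum_action_def cinner_prod_def)
  qed
  obtain M \<delta> where M: "csubspace M" "closed M" "M \<noteq> {0}" "M \<subseteq> W"
    and \<delta>: "\<delta> > 0" "\<And>w. w \<in> M \<Longrightarrow> \<delta> * norm w \<le> norm (fst w)"
      "\<And>w. w \<in> M \<Longrightarrow> \<delta> * norm w \<le> norm (snd w)"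
    and Minv: "\<And>U w. bounded_linear U \<Longrightarrow> (\<And>x. U (orth_proj W x) = orth_proj W (U x)) \<Longrightarrow>
       (\<And>x. U (fst x, 0) = (fst (U x), 0)) \<Longrightarrow> w \<in> M \<Longrightarrow> U w \<in> M"
    by (fact ex_subspace_coordinates_bounded_below[OF WD(1,2) W0 fst0 snd0])
  \<comment> \<open>The representation is diagonal, hence commutes with the coordinate projection;
    it commutes with the projection onto \<open>W\<close> because \<open>W\<close> is
    invariant.\<close>
  have "?\<pi> g w \<in> M" if "w \<in> M" for g w
  proof (rule Minv[OF bounded_linear_unitary_rep[OF \<pi>] _ _ that])
    show "?\<pi> g (orth_proj W x) = orth_proj W (?\<pi> g x)" for x
      by (simp add: orth_proj_unitary_rep[OF \<pi> W])
    show "?\<pi> g (fst x, 0) = (fst (?\<pi> g x), 0)" for x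
      by (cases x) (simp add: direct_sum_action_def unitary_rep_zero[OF \<pi>\<^sub>2(1)])
  qed
  then have MI: "closed_invariant_subspace ?\<pi> M"
    using M by (auto simp: closed_invariant_subspace_def)
  have fixed: "orth_proj M (?\<alpha> g s) = orth_proj M s" for g
  proof -
    have "orth_proj M (?\<alpha> g s - s) = 0"
      using orthW M(4) by (auto simp: orth_proj_eq_0_iff[OF M(1,2)])
    then show ?thesis by (simp add: orth_proj_diff[OF M(1,2)])
  qed
  obtain w where w: "w \<in> M" "w \<noteq> 0" using M(3) complex_vector.subspace_0[OF M(1)] by blast
  then have "0 < \<delta> * norm w" using \<delta>(1) by simp
  then have "fst w \<noteq> 0" "snd w \<noteq> 0" using \<delta>(2,3)[OF w(1)] by auto
  then have "fst ` M \<noteq> {0}" "snd ` M \<noteq> {0}" using w(1) by auto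
  with equivalent_projected_actions_of_graph[OF \<pi>\<^sub>1 \<pi>\<^sub>2 MI fixed \<delta>] show ?thesis
    by (intro that) (simp_all add: lp\<^sub>1 lp\<^sub>2)
qed

theorem theorem5p2:
  fixes \<alpha>\<^sub>1 :: "'g::topological_group_add \<Rightarrow> 'a::complex_hilbert \<Rightarrow> 'a"
    and \<alpha>\<^sub>2 :: "'g \<Rightarrow> 'b::complex_hilbert \<Rightarrow> 'b"
  assumes "affine_isometric_action \<alpha>\<^sub>1" and "irreducible_action \<alpha>\<^sub>1"
    and "affine_isometric_action \<alpha>\<^sub>2" and "irreducible_action \<alpha>\<^sub>2"
  shows "\<not> irreducible_action (\<alpha>\<^sub>1 \<oplus>\<^sub>a \<alpha>\<^sub>2) \<longleftrightarrow>
    (\<exists>K\<^sub>1 K\<^sub>2.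
       closed_invariant_subspace (linear_part \<alpha>\<^sub>1) K\<^sub>1 \<and> K\<^sub>1 \<noteq> {0} \<and>
       closed_invariant_subspace (linear_part \<alpha>\<^sub>2) K\<^sub>2 \<and> K\<^sub>2 \<noteq> {0} \<and>
       equivalent_actions K\<^sub>1 (projected_action \<alpha>\<^sub>1 K\<^sub>1) K\<^sub>2 (projected_action \<alpha>\<^sub>2 K\<^sub>2))"
  using equivalent_projected_actions_if_reducible[OF assms]
    reducible_if_equivalent_projected_actions[OF assms(1,3)]
  by metis

end
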